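(* For every real $\delta \geq 11$, the Gabor system $\mathcal{G}\big(h_{15}, \tfrac{1}{\sqrt{\delta}}\,\mathbb{Z}^2\big)$ is a frame for $L^2(\mathbb{R})$.
   Context: For $n \in \mathbb{N}_0$, the $n$-th Hermite function (of unit $L^2(\mathbb{R})$-norm) is $h_n(t) = c_n (-1)^n e^{\pi t^2} \frac{d^n}{dt^n} e^{-2\pi t^2}$, $t\in\mathbb{R}$, with $c_n = 2^{1/4}/\sqrt{n!\,(2\pi)^n 2^n}$. For $z=(x,\omega)\in\mathbb{R}^2$ the time-frequency shift $\pi(z)$ acts on $g\in L^2(\mathbb{R})$ by $\pi(z)g(t) = e^{2\pi i \omega t} g(t-x)$. For a lattice $\Lambda\subset\mathbb{R}^2$ the Gabor system is $\mathcal{G}(g,\Lambda)=\{\pi(\lambda)g \mid \lambda\in\Lambda\}$. It is a frame for $L^2(\mathbb{R})$ if there exist constants $0<A\leq B<\infty$ such that $A\|f\|_{L^2(\mathbb{R})}^2 \leq \sum_{\lambda\in\Lambda} |\langle f,\pi(\lambda)g\rangle|^2 \leq B\|f\|_{L^2(\mathbb{R})}^2$ for all $f\in L^2(\mathbb{R})$, where $\langle f,g\rangle=\int_{\mathbb{R}} f(t)\overline{g(t)}\,dt$. *)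

theory Defs
  imports "HOL-Analysis.Analysis"
begin

text \<open>
  Elements of \<open>L\<^sup>2(\<real>)\<close> are handled through their representatives: Lebesgue measurable,
  complex-valued functions with integrable squared modulus.  Everything below depends on
  such a function only up to equality almost everywhere.
\<close>

definition L2 :: "(real \<Rightarrow> complex) set" where
  "L2 = {f \<in> borel_measurable lebesgue. integrable lebesgue (\<lambda>t. (norm (f t))\<^sup>2)}"

definition L2_norm :: "(real \<Rightarrow> complex) \<Rightarrow> real" where
  "L2_norm f = sqrt (LINT t|lebesgue. (norm (f t))\<^sup>2)"

definition L2_inner :: "(real \<Rightarrow> complex) \<Rightarrow> (real \<Rightarrow> complex) \<Rightarrow> complex" where
  "L2_inner f g = (LINT t|lebesgue. f t * cnj (g t))"

text \<open>
  A frame is an indexed family \<open>(\<phi> i)\<close>, \<open>i \<in> I\<close>, so that the sum runs over indices.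
  Summability is stated explicitly because \<^const>\<open>infsum\<close> is 0 for non-summable families.
\<close>

definition L2_frame :: "'i set \<Rightarrow> ('i \<Rightarrow> real \<Rightarrow> complex) \<Rightarrow> bool" where
  "L2_frame I \<phi> \<longleftrightarrow>
     (\<forall>i\<in>I. \<phi> i \<in> L2) \<and>
     (\<exists>A B. 0 < A \<and> A \<le> B \<and>
       (\<forall>f\<in>L2.
          (\<lambda>i. (norm (L2_inner f (\<phi> i)))\<^sup>2) summable_on I \<and>
          A * (L2_norm f)\<^sup>2 \<le> (\<Sum>\<^sub>\<infinity>i\<in>I. (norm (L2_inner f (\<phi> i)))\<^sup>2) \<and>
          (\<Sum>\<^sub>\<infinity>i\<in>I. (norm (L2_inner f (\<phi> i)))\<^sup>2) \<le> B * (L2_norm f)\<^sup>2))"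

definition tf_shift :: "real \<times> real \<Rightarrow> (real \<Rightarrow> complex) \<Rightarrow> real \<Rightarrow> complex" where
  "tf_shift = (\<lambda>(x, \<omega>) g t. exp (2 * of_real pi * \<i> * of_real \<omega> * of_real t) * g (t - x))"

definition gabor_system :: "(real \<Rightarrow> complex) \<Rightarrow> real \<times> real \<Rightarrow> real \<Rightarrow> complex" where
  "gabor_system g = (\<lambda>z. tf_shift z g)"

definition gabor_frame :: "(real \<Rightarrow> complex) \<Rightarrow> (real \<times> real) set \<Rightarrow> bool" where
  "gabor_frame g \<Lambda> \<longleftrightarrow> L2_frame \<Lambda> (gabor_system g)"

definition scaled_int_lattice :: "real \<Rightarrow> (real \<times> real) set" where
  "scaled_int_lattice a = {(a * of_int k, a * of_int l) | k l :: int. True}"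

definition hermite_const :: "nat \<Rightarrow> real" where
  "hermite_const n = 2 powr (1 / 4) / sqrt (fact n * (2 * pi) ^ n * 2 ^ n)"

definition hermite_fun :: "nat \<Rightarrow> real \<Rightarrow> real" where
  "hermite_fun n t =
     hermite_const n * (- 1) ^ n * exp (pi * t\<^sup>2) *
     (deriv ^^ n) (\<lambda>s. exp (- 2 * pi * s\<^sup>2)) t"

end

theory Submission
  imports Defs "HOL-Probability.Characteristic_Functions" "HOL-Probability.Sinc_Integral"
    "HOL-Computational_Algebra.Polynomial"
begin

text \<open>
  Write \<open>h\<close> for the Hermite function of order 15, \<open>a = 1 / sqrt \<delta>\<close> and \<open>T = sqrt \<delta>\<close>.  The proof
  expands the Gabor frame operator over the dual lattice \<open>T \<int>\<^sup>2\<close> (the Janssen representation).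
  For continuous \<open>f\<close> of compact support, Parseval's identity for the \<open>T\<close>-periodization of
  \<open>f(t) h(t - a k)\<close> sums the frame coefficients over the modulations, and summing over the
  translations \<open>k\<close> then gives

    \<open>\<Sum>\<^bsub>k,l\<^esub> \<bar>\<langle>f, \<pi>(a k, a l) h\<rangle>\<bar>\<^sup>2 = T \<Sum>\<^bsub>j\<^esub> \<integral> f(t) cnj (f(t + j T)) G\<^bsub>j\<^esub>(t) dt\<close>,

  where \<open>G\<^bsub>j\<^esub>\<close> is the \<open>a\<close>-periodization of \<open>h(t) h(t + j T)\<close>.  The \<open>m\<close>-th Fourier coefficient of
  \<open>G\<^bsub>j\<^esub>\<close> is \<open>1/a\<close> times the ambiguity function of \<open>h\<close> at the point \<open>(j T, m T)\<close>.  It is \<open>1/a\<close> for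
  \<open>j = m = 0\<close>, which contributes \<open>\<delta> \<parallel>f\<parallel>\<^sup>2\<close>; all other coefficients together contribute at most
  \<open>\<delta> s \<parallel>f\<parallel>\<^sup>2\<close>, where \<open>s\<close> is the sum of the moduli of the ambiguity function over the nonzero
  points of the dual lattice.  Hence \<open>\<delta> (1 - s)\<close> and \<open>\<delta> (1 + s)\<close> are frame bounds as soon as
  \<open>s < 1\<close> (lemma \<open>gabor_coeff_estimate\<close>); density of the continuous functions of compact support
  extends the bounds to all square-integrable functions (lemma \<open>L2_frame_from_dense\<close>).

  The ladder relations for Hermite functions determine the ambiguity function: at a point of
  squared length \<open>r\<close> its modulus is \<open>\<bar>L(\<pi> r)\<bar> exp (-\<pi> r / 2)\<close> with the Laguerre polynomial
  \<open>L = L\<^bsub>15\<^esub>\<close> (lemma \<open>norm_hermite_ambiguity\<close>).  It remains to sum this over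
  \<open>r = \<delta> (j\<^sup>2 + m\<^sup>2)\<close> for \<open>\<delta> \<ge> 11\<close> (lemma \<open>sum_lattice_weight_le\<close>).  A monotonicity argument of Sonin
  type, based on Laguerre's differential equation, bounds \<open>\<bar>L(x)\<bar> exp (-x/2)\<close> by 19/100 for
  \<open>x \<ge> 31\<close> and by 4/100 for \<open>x \<ge> 69\<close>; these apply to the four points with \<open>j\<^sup>2 + m\<^sup>2 = 1\<close> and the
  four points with \<open>j\<^sup>2 + m\<^sup>2 = 2\<close>, and a crude exponential bound shows that the remaining points
  are negligible.  Altogether \<open>s \<le> 95/100\<close>.
\<close>

section \<open>Functions with quadratic decay\<close>

lemma integrable_inverse_quadratic: "integrable lborel (\<lambda>t::real. C / (1 + t\<^sup>2))"
proof -
  have "integrable lborel (\<lambda>t::real. inverse (1 + t\<^sup>2))"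
    using integrable_inverse_1_plus_square by (simp add: set_integrable_def)
  from integrable_mult_right[OF this, of C] show ?thesis
    by (simp add: field_simps)
qed

lemma integrable_quadratic_decay:
  fixes u :: "real \<Rightarrow> complex"
  assumes "continuous_on UNIV u" "\<And>t. norm (u t) \<le> C / (1 + t\<^sup>2)"
  shows "integrable lborel u"
  using integrable_inverse_quadratic[of C]
proof (rule Bochner_Integration.integrable_bound)
  show "u \<in> borel_measurable lborel"
    using borel_measurable_continuous_onI[OF assms(1)] by simp
  show "AE t in lborel. norm (u t) \<le> norm (C / (1 + t\<^sup>2))"
    using order_trans[OF assms(2) abs_ge_self] by (intro AE_I2) simp
qed

lemma quadratic_decay_tendsto_0:
  fixes u :: "real \<Rightarrow> complex"
  assumes "\<And>t. norm (u t) \<le> C / (1 + t\<^sup>2)" and F: "F = at_top \<or> F = at_bot"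
  shows "(u \<longlongrightarrow> 0) F"
proof (rule Lim_null_comparison)
  show "\<forall>\<^sub>F t in F. norm (u t) \<le> C / (1 + t\<^sup>2)"
    using assms(1) by simp
  have 2: "(0::nat) < 2" by simp
  have "filterlim (\<lambda>t::real. t\<^sup>2) at_top F"
    using F filterlim_pow_at_top[OF 2 filterlim_ident] filterlim_pow_at_bot_even[OF 2 filterlim_ident]
    by auto
  hence "filterlim (\<lambda>t::real. 1 + t\<^sup>2) at_top F"
    by (intro filterlim_tendsto_add_at_top[OF tendsto_const])
  thus "((\<lambda>t. C / (1 + t\<^sup>2)) \<longlongrightarrow> 0) F"
    by (intro tendsto_divide_0[OF tendsto_const] filterlim_at_top_imp_at_infinity)
qed

text \<open>
  Integration by parts on the line, in the form that the derivative of a decaying function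
  has integral zero.
\<close>

lemma integral_derivative_eq_0:
  fixes W W' :: "real \<Rightarrow> complex"
  assumes der: "\<And>t. (W has_vector_derivative W' t) (at t)"
    and cont: "continuous_on UNIV W'"
    and "\<And>t. norm (W t) \<le> C / (1 + t\<^sup>2)"
    and "integrable lborel W'"
  shows "(LINT t|lborel. W' t) = 0"
proof -
  have "(LBINT x=-\<infinity>..\<infinity>. W' x) = 0 - 0"
  proof (rule interval_integral_FTC_integrable[where F = W])
    show "isCont W' x" for x
      using cont by (simp add: continuous_on_eq_continuous_at)
    show "((W \<circ> real_of_ereal) \<longlongrightarrow> 0) (at_right (-\<infinity>))" "((W \<circ> real_of_ereal) \<longlongrightarrow> 0) (at_left \<infinity>)"
      unfolding ereal_tendsto_simps using quadratic_decay_tendsto_0[OF assms(3)] by auto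
  qed (use assms in \<open>auto simp: set_integrable_def\<close>)
  thus ?thesis by (simp add: interval_lebesgue_integral_def set_lebesgue_integral_def)
qed

section \<open>Hermite functions and the ladder relations\<close>

text \<open>
  The Hermite polynomials in the normalization belonging to the weight \<open>exp (- 2 \<pi> t\<^sup>2)\<close>: the
  \<open>n\<close>-th derivative of this weight is the weight times \<open>(-1)\<^sup>n\<close> times the \<open>n\<close>-th polynomial.
\<close>

fun herm_poly :: "nat \<Rightarrow> real poly" where
  "herm_poly 0 = 1"
| "herm_poly (Suc n) = [:0, 4 * pi:] * herm_poly n - pderiv (herm_poly n)"

text \<open>
  The Hermite functions without the normalizing constant.
\<close>

definition herm_gauss :: "nat \<Rightarrow> real \<Rightarrow> real" where
  "herm_gauss n t = poly (herm_poly n) t * exp (- pi * t\<^sup>2)"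

lemma pderiv_herm_poly: "pderiv (herm_poly n) = smult (4 * pi * n) (herm_poly (n - 1))"
proof (induction n)
  case (Suc n)
  have "pderiv (herm_poly (Suc n)) = [:4 * pi:] * herm_poly n + [:0, 4 * pi:] * pderiv (herm_poly n) - pderiv (pderiv (herm_poly n))"
    by (simp add: pderiv_diff pderiv_mult pderiv_pCons pderiv_smult)
  moreover have "[:0, 4 * pi:] * pderiv (herm_poly n) - pderiv (pderiv (herm_poly n)) = smult (4 * pi * n) (herm_poly n)"
  proof (cases n)
    case (Suc m)
    have "pderiv (pderiv (herm_poly n)) = smult (4 * pi * n) (pderiv (herm_poly m))"
      unfolding Suc.IH by (simp add: pderiv_smult Suc)
    thus ?thesis unfolding Suc.IH using Suc by (simp add: smult_diff_right)
  qed (simp add: pderiv_1)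
  ultimately have "pderiv (herm_poly (Suc n)) = [:4 * pi:] * herm_poly n + smult (4 * pi * n) (herm_poly n)"
    by (simp only: add_diff_eq[symmetric])
  thus ?case by (simp add: algebra_simps smult_add_left)
qed (simp add: pderiv_1)

lemma hermite_derivatives:
  "(deriv ^^ n) (\<lambda>s. exp (- 2 * pi * s\<^sup>2)) = (\<lambda>t. (-1)^n * poly (herm_poly n) t * exp (- 2 * pi * t\<^sup>2))"
proof (induction n)
  case (Suc n)
  have "((\<lambda>t. (-1)^n * poly (herm_poly n) t * exp (- 2 * pi * t\<^sup>2)) has_real_derivative
      (-1)^Suc n * poly (herm_poly (Suc n)) t * exp (- 2 * pi * t\<^sup>2)) (at t)" for t
    by (rule derivative_eq_intros poly_DERIV refl | simp)+ (simp add: algebra_simps)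
  hence "deriv (\<lambda>t. (-1)^n * poly (herm_poly n) t * exp (- 2 * pi * t\<^sup>2)) =
     (\<lambda>t. (-1)^Suc n * poly (herm_poly (Suc n)) t * exp (- 2 * pi * t\<^sup>2))"
    by (intro ext DERIV_imp_deriv)
  thus ?case using Suc by simp
qed simp

lemma hermite_fun_eq: "hermite_fun n t = hermite_const n * herm_gauss n t"
proof -
  have e: "exp (pi * t\<^sup>2) * exp (- 2 * pi * t\<^sup>2) = exp (- pi * t\<^sup>2)"
    unfolding exp_add[symmetric] by (rule arg_cong[where f = exp]) (simp add: algebra_simps)
  have s: "(-1)^n * (-1)^n = (1::real)" by (simp flip: power_mult_distrib)
  have "hermite_fun n t = hermite_const n * ((-1)^n * (-1)^n) * poly (herm_poly n) t *
     (exp (pi * t\<^sup>2) * exp (- 2 * pi * t\<^sup>2))"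
    unfolding hermite_fun_def hermite_derivatives by (simp only: mult_ac)
  thus ?thesis unfolding e s herm_gauss_def by simp
qed

lemma continuous_herm_gauss [continuous_intros]:
  "continuous_on A f \<Longrightarrow> continuous_on A (\<lambda>x. herm_gauss n (f x))"
  unfolding herm_gauss_def by (intro continuous_intros)

text \<open>
  The derivative of a Hermite function can be expressed through the next or through the
  previous one.  These raising and lowering relations drive the recursions for the ambiguity
  function.  At \<open>n = 0\<close> the truncated index in the lowering relation is harmless because its
  coefficient vanishes.
\<close>

lemma herm_gauss_raise:
  "(herm_gauss n has_real_derivative 2 * pi * t * herm_gauss n t - herm_gauss (Suc n) t) (at t)"
  unfolding herm_gauss_def[abs_def]
  by (rule derivative_eq_intros poly_DERIV refl | simp)+ (simp add: algebra_simps)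

lemma herm_gauss_lower:
  "(herm_gauss n has_real_derivative 4 * pi * n * herm_gauss (n - 1) t - 2 * pi * t * herm_gauss n t) (at t)"
  unfolding herm_gauss_def[abs_def]
  by (rule derivative_eq_intros poly_DERIV refl | simp)+ (simp add: algebra_simps pderiv_herm_poly)

lemma poly_le_gaussian:
  fixes p :: "real poly"
  assumes "s > 0"
  shows "\<exists>C. \<forall>t. \<bar>poly p t\<bar> \<le> C * exp (s * t\<^sup>2)"
  using assms
proof (induction p arbitrary: s)
  case 0
  show ?case by (intro exI[of _ 0]) simp
next
  case (pCons a p)
  have "s/2 > 0" using pCons.prems by simp
  from pCons.IH[OF this] obtain C where C: "\<And>t. \<bar>poly p t\<bar> \<le> C * exp (s/2 * t\<^sup>2)" by blast
  have "\<bar>poly p 0\<bar> \<le> C" using C[of 0] by simp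
  hence C0: "C \<ge> 0" by simp
  have lin: "\<bar>t\<bar> \<le> (1 + 2/s) * exp (s/2 * t\<^sup>2)" for t :: real
  proof -
    have "0 \<le> (\<bar>t\<bar> - 1)^2" by simp
    hence "\<bar>t\<bar> \<le> 1 + t\<^sup>2" unfolding power2_diff by simp
    also have "\<dots> \<le> (1 + 2/s) * (1 + s/2 * t\<^sup>2)"
      using pCons.prems by (simp add: field_simps)
    also have "\<dots> \<le> (1 + 2/s) * exp (s/2 * t\<^sup>2)"
      using pCons.prems by (intro mult_left_mono exp_ge_add_one_self) auto
    finally show ?thesis .
  qed
  show ?case
  proof (intro exI allI)
    fix t
    have "\<bar>poly (pCons a p) t\<bar> \<le> \<bar>a\<bar> + \<bar>t\<bar> * \<bar>poly p t\<bar>"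
      by (simp add: abs_mult[symmetric] abs_triangle_ineq)
    also have "\<dots> \<le> \<bar>a\<bar> * exp (s * t\<^sup>2) + (1 + 2/s) * exp (s/2 * t\<^sup>2) * (C * exp (s/2 * t\<^sup>2))"
      using pCons.prems by (intro add_mono mult_mono lin C mult_nonneg_nonneg mult_right_le_one_le) (auto simp: mult_le_cancel_left1)
    also have "\<dots> = (\<bar>a\<bar> + (1 + 2/s) * C) * exp (s * t\<^sup>2)"
      by (simp add: algebra_simps flip: exp_add)
    finally show "\<bar>poly (pCons a p) t\<bar> \<le> (\<bar>a\<bar> + (1 + 2/s) * C) * exp (s * t\<^sup>2)" .
  qed
qed

lemma herm_gauss_decay: "\<exists>C. \<forall>t. \<bar>herm_gauss n t\<bar> \<le> C / (1 + t\<^sup>2)"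
proof -
  obtain C where C: "\<And>t. \<bar>poly (herm_poly n) t\<bar> \<le> C * exp (1 * t\<^sup>2)"
    using poly_le_gaussian[of 1] by auto
  have "\<bar>herm_gauss n t\<bar> \<le> C / (1 + t\<^sup>2)" for t
  proof -
    have C0: "C \<ge> 0" using order_trans[OF abs_ge_zero C[of 0]] by simp
    have "\<bar>herm_gauss n t\<bar> * (1 + t\<^sup>2) \<le> (C * exp (t\<^sup>2)) * exp (- pi * t\<^sup>2) * exp (t\<^sup>2)"
      unfolding herm_gauss_def abs_mult using C[of t] C0
      by (intro mult_mono) (auto intro: exp_ge_add_one_self)
    also have "\<dots> = C * exp ((2 - pi) * t\<^sup>2)"
      by (simp add: algebra_simps flip: exp_add)
    also have "\<dots> \<le> C * 1"
      using C0 pi_ge_two by (intro mult_left_mono) (auto simp: mult_nonpos_nonneg)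
    finally show ?thesis by (simp add: pos_le_divide_eq add_pos_nonneg)
  qed
  thus ?thesis by blast
qed

section \<open>The ambiguity function and Laguerre polynomials\<close>

text \<open>
  The cross-ambiguity function of two unnormalized Hermite functions, at translation \<open>x\<close> and
  frequency \<open>w\<close>.
\<close>

definition ambiguity :: "nat \<Rightarrow> nat \<Rightarrow> real \<Rightarrow> real \<Rightarrow> complex" where
  "ambiguity m n x w = (LINT t|lborel. of_real (herm_gauss m t * herm_gauss n (t + x)) * cis (- 2 * pi * w * t))"

lemma ambiguity_decay:
  "\<exists>C. \<forall>t. norm (of_real (herm_gauss m t * herm_gauss n (t + x)) * cis (- 2 * pi * w * t)) \<le> C / (1 + t\<^sup>2)"
proof -
  obtain C where C: "\<And>t. \<bar>herm_gauss m t\<bar> \<le> C / (1 + t\<^sup>2)" using herm_gauss_decay by blast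
  obtain D where D: "\<And>t. \<bar>herm_gauss n t\<bar> \<le> D / (1 + t\<^sup>2)" using herm_gauss_decay by blast
  have D0: "D \<ge> 0" using order_trans[OF abs_ge_zero D[of 0]] by simp
  have "\<bar>herm_gauss n t\<bar> \<le> D" for t
    using order_trans[OF D[of t], of D] D0 by (simp add: divide_le_eq mult_le_cancel_left1 add_pos_nonneg)
  hence "\<bar>herm_gauss m t\<bar> * \<bar>herm_gauss n (t + x)\<bar> \<le> C / (1 + t\<^sup>2) * D" for t
    using order_trans[OF abs_ge_zero C[of t]] by (intro mult_mono C) auto
  thus ?thesis by (intro exI[of _ "C * D"]) (auto simp: norm_mult abs_mult)
qed

lemma integrable_ambiguity:
  "integrable lborel (\<lambda>t. of_real (herm_gauss m t * herm_gauss n (t + x)) * cis (- 2 * pi * w * t))"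
proof -
  have "continuous_on UNIV (\<lambda>t. complex_of_real (herm_gauss m t * herm_gauss n (t + x)) * cis (- 2 * pi * w * t))"
    by (intro continuous_intros)
  moreover obtain C where "norm (of_real (herm_gauss m t * herm_gauss n (t + x)) * cis (- 2 * pi * w * t)) \<le> C / (1 + t\<^sup>2)" for t
    using ambiguity_decay by blast
  ultimately show ?thesis by (rule integrable_quadratic_decay)
qed

lemma has_vector_derivative_cis:
  "((\<lambda>t. cis (c * t)) has_vector_derivative \<i> * of_real c * cis (c * t)) (at t)"
proof -
  have "((\<lambda>z. exp (\<i> * of_real c * z)) has_field_derivative \<i> * of_real c * exp (\<i> * of_real c * of_real t))
      (at (of_real t))"
    by (rule derivative_eq_intros refl | simp)+
  from has_vector_derivative_real_field[OF this] show ?thesis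
    by (simp add: cis_conv_exp mult.assoc)
qed

lemma ambiguity_integrand_deriv:
  fixes a b :: real
  assumes "(herm_gauss m has_real_derivative a) (at t)"
    and "(herm_gauss n has_real_derivative b) (at (t + x))"
  shows "((\<lambda>t. of_real (herm_gauss m t * herm_gauss n (t + x)) * cis (- 2 * pi * w * t)) has_vector_derivative
     of_real (a * herm_gauss n (t + x) + herm_gauss m t * b) * cis (- 2 * pi * w * t)
      - 2 * pi * \<i> * w * (of_real (herm_gauss m t * herm_gauss n (t + x)) * cis (- 2 * pi * w * t))) (at t)"
proof -
  have "((\<lambda>t. herm_gauss m t * herm_gauss n (t + x)) has_real_derivative
      (a * herm_gauss n (t + x) + b * herm_gauss m t)) (at t)"
    using DERIV_mult[OF assms(1) DERIV_shift[THEN iffD1, OF assms(2)]] .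
  hence "((\<lambda>t. complex_of_real (herm_gauss m t * herm_gauss n (t + x))) has_vector_derivative
      of_real (a * herm_gauss n (t + x) + b * herm_gauss m t)) (at t)"
    by (intro has_vector_derivative_of_real)
       (simp add: has_real_derivative_iff_has_vector_derivative)
  from has_vector_derivative_mult[OF this has_vector_derivative_cis[of "- 2 * pi * w"]]
  show ?thesis by (simp add: algebra_simps)
qed

text \<open>
  Moving the raising operator from the first factor to the second turns it into the lowering
  operator; commuting it past the time-frequency shift produces the factor \<open>x + \<i> w\<close>.
\<close>

lemma ambiguity_Suc:
  "ambiguity (Suc m) n x w = 4 * pi * n * ambiguity m (n - 1) x w - 2 * pi * (x + \<i> * w) * ambiguity m n x w"
proof -
  let ?u = "\<lambda>m n t. complex_of_real (herm_gauss m t * herm_gauss n (t + x)) * cis (- 2 * pi * w * t)"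
  let ?W = "\<lambda>t. 4 * pi * n * ?u m (n - 1) t - 2 * pi * (x + \<i> * w) * ?u m n t - ?u (Suc m) n t"
  obtain C where C: "\<And>t. norm (?u m n t) \<le> C / (1 + t\<^sup>2)" using ambiguity_decay by blast
  have "(LINT t|lborel. ?W t) = 0"
  proof (rule integral_derivative_eq_0)
    show "((\<lambda>t. ?u m n t) has_vector_derivative ?W t) (at t)" for t
      by (rule has_vector_derivative_eq_rhs[OF ambiguity_integrand_deriv[OF herm_gauss_raise herm_gauss_lower]])
         (simp add: algebra_simps)
    show "continuous_on UNIV ?W" by (intro continuous_intros)
    show "integrable lborel ?W"
      by (intro Bochner_Integration.integrable_diff integrable_mult_right integrable_ambiguity)
  qed (rule C)
  also have "(LINT t|lborel. ?W t) = 4 * pi * n * ambiguity m (n - 1) x w - 2 * pi * (x + \<i> * w) * ambiguity m n x w - ambiguity (Suc m) n x w"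
    unfolding ambiguity_def
    by (simp only: Bochner_Integration.integral_diff Bochner_Integration.integrable_diff
        integral_mult_right_zero integrable_mult_right integrable_ambiguity)
  finally show ?thesis by simp
qed

lemma ambiguity_0_Suc: "ambiguity 0 (Suc n) x w = 2 * pi * (x - \<i> * w) * ambiguity 0 n x w"
proof -
  let ?u = "\<lambda>m n t. complex_of_real (herm_gauss m t * herm_gauss n (t + x)) * cis (- 2 * pi * w * t)"
  let ?W = "\<lambda>t. 2 * pi * (x - \<i> * w) * ?u 0 n t - ?u 0 (Suc n) t"
  obtain C where C: "\<And>t. norm (?u 0 n t) \<le> C / (1 + t\<^sup>2)" using ambiguity_decay by blast
  have "(LINT t|lborel. ?W t) = 0"
  proof (rule integral_derivative_eq_0)
    show "((\<lambda>t. ?u 0 n t) has_vector_derivative ?W t) (at t)" for t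
      by (rule has_vector_derivative_eq_rhs[OF ambiguity_integrand_deriv[OF herm_gauss_lower herm_gauss_raise]])
         (simp add: algebra_simps)
    show "continuous_on UNIV ?W" by (intro continuous_intros)
    show "integrable lborel ?W"
      by (intro Bochner_Integration.integrable_diff integrable_mult_right integrable_ambiguity)
  qed (rule C)
  also have "(LINT t|lborel. ?W t) = 2 * pi * (x - \<i> * w) * ambiguity 0 n x w - ambiguity 0 (Suc n) x w"
    unfolding ambiguity_def
    by (simp only: Bochner_Integration.integral_diff Bochner_Integration.integrable_diff
        integral_mult_right_zero integrable_mult_right integrable_ambiguity)
  finally show ?thesis by simp
qed

text \<open>
  The Gaussian case reduces to the characteristic function of the standard normal distribution
  by completing the square: the two Gaussians are centred at \<open>0\<close> and \<open>-x\<close>, hence their product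
  at \<open>-x/2\<close>.
\<close>

lemma ambiguity_0_0: "ambiguity 0 0 x w = exp (- pi * (x\<^sup>2 + w\<^sup>2) / 2) / sqrt 2 * cis (pi * w * x)"
proof -
  \<comment> \<open>The substitution \<open>t = c s - x/2\<close> turns the product of the two Gaussians into the standard normal density in \<open>s\<close>.\<close>
  define c where "c = 1 / (2 * sqrt pi)"
  have c: "c > 0" "c\<^sup>2 = 1 / (4 * pi)" by (auto simp: c_def power_divide power_mult_distrib)
  have "ambiguity 0 0 x w = c *\<^sub>R (LINT s|lborel. of_real (herm_gauss 0 (- x/2 + c * s) * herm_gauss 0 ((- x/2 + c * s) + x)) * cis (- 2 * pi * w * (- x/2 + c * s)))"
    unfolding ambiguity_def using c by (subst lborel_integral_real_affine[of c _ "- x/2"]) auto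
  also have "(\<lambda>s. of_real (herm_gauss 0 (- x/2 + c * s) * herm_gauss 0 ((- x/2 + c * s) + x)) * cis (- 2 * pi * w * (- x/2 + c * s)))
    = (\<lambda>s. (of_real (sqrt (2 * pi) * exp (- pi * x\<^sup>2 / 2)) * cis (pi * w * x)) * (std_normal_density s *\<^sub>R iexp ((- 2 * pi * w * c) * s)))"
  proof
    fix s
    have "- pi * (- x/2 + c * s)\<^sup>2 - pi * ((- x/2 + c * s) + x)\<^sup>2 = - 2 * pi * c\<^sup>2 * s\<^sup>2 - pi * x\<^sup>2 / 2"
      by (simp add: power2_eq_square field_simps)
    also have "\<dots> = - s\<^sup>2 / 2 - pi * x\<^sup>2 / 2" by (simp add: c)
    finally have 1: "herm_gauss 0 (- x/2 + c * s) * herm_gauss 0 ((- x/2 + c * s) + x) = exp (- s\<^sup>2 / 2) * exp (- pi * x\<^sup>2 / 2)"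
      unfolding herm_gauss_def by (simp flip: exp_add)
    have 2: "cis (- 2 * pi * w * (- x/2 + c * s)) = cis (pi * w * x) * iexp ((- 2 * pi * w * c) * s)"
      unfolding cis_conv_exp[symmetric] cis_mult by (simp add: algebra_simps)
    show "of_real (herm_gauss 0 (- x/2 + c * s) * herm_gauss 0 ((- x/2 + c * s) + x)) * cis (- 2 * pi * w * (- x/2 + c * s))
     = (of_real (sqrt (2 * pi) * exp (- pi * x\<^sup>2 / 2)) * cis (pi * w * x)) * (std_normal_density s *\<^sub>R iexp ((- 2 * pi * w * c) * s))"
      unfolding 1 2 by (simp add: std_normal_density_def scaleR_conv_of_real)
  qed
  also have "(LINT s|lborel. (of_real (sqrt (2 * pi) * exp (- pi * x\<^sup>2 / 2)) * cis (pi * w * x)) * (std_normal_density s *\<^sub>R iexp ((- 2 * pi * w * c) * s)))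
    = (of_real (sqrt (2 * pi) * exp (- pi * x\<^sup>2 / 2)) * cis (pi * w * x)) * char std_normal_distribution (- 2 * pi * w * c)"
  proof -
    have "char std_normal_distribution a = (LINT s|lborel. std_normal_density s *\<^sub>R iexp (a * s))" for a
      unfolding char_def by (rule integral_density) (auto intro!: borel_measurable_continuous_onI continuous_intros)
    thus ?thesis by (simp only: integral_mult_right_zero)
  qed
  also have "char std_normal_distribution (- 2 * pi * w * c) = of_real (exp (- pi * w\<^sup>2 / 2))"
    unfolding char_std_normal_distribution
    by (simp add: power_mult_distrib c) (simp add: power2_eq_square)
  also have "c *\<^sub>R (of_real (sqrt (2 * pi) * exp (- pi * x\<^sup>2 / 2)) * cis (pi * w * x) * of_real (exp (- pi * w\<^sup>2 / 2)))
    = of_real (c * sqrt (2 * pi) * (exp (- pi * x\<^sup>2 / 2) * exp (- pi * w\<^sup>2 / 2))) * cis (pi * w * x)"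
    by (simp add: scaleR_conv_of_real)
  also have "c * sqrt (2 * pi) = 1 / sqrt 2"
    by (simp add: c_def real_sqrt_mult field_simps)
  also have "exp (- pi * x\<^sup>2 / 2) * exp (- pi * w\<^sup>2 / 2) = exp (- pi * (x\<^sup>2 + w\<^sup>2) / 2)"
    by (simp add: field_simps flip: exp_add)
  finally show ?thesis by simp
qed

text \<open>
  The Laguerre polynomial of degree \<open>n\<close>, with value 1 at 0.
\<close>

definition laguerre :: "nat \<Rightarrow> real \<Rightarrow> real" where
  "laguerre n x = (\<Sum>j\<le>n. of_nat (n choose j) / fact j * (-x)^j)"

lemma ambiguity_0_n: "ambiguity 0 n x w = (2 * pi * (x - \<i> * w)) ^ n * ambiguity 0 0 x w"
  by (induction n) (simp_all add: ambiguity_0_Suc)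

text \<open>
  The combinatorial content of the recursion \<open>ambiguity_Suc\<close>: Pascal's rule for the closed form
  of its solution.
\<close>

lemma ladder_sum_Suc:
  fixes a b c :: "'a :: comm_semiring_1"
  defines "Q \<equiv> \<lambda>m n. \<Sum>k\<le>m. of_nat ((m choose k) * ((n choose k) * fact k)) * a ^ k * b ^ (m - k) * c ^ (n - k)"
  shows "Q (Suc m) n = a * of_nat n * Q m (n - 1) + b * Q m n"
proof -
  let ?f = "\<lambda>j k. of_nat (j * ((n choose k) * fact k)) * a ^ k * b ^ (Suc m - k) * c ^ (n - k)"
  have ff: "n * ((n - 1 choose k) * fact k) = (n choose Suc k) * fact (Suc k)" for k
  proof (cases n)
    case (Suc l)
    thus ?thesis using Suc_times_binomial_eq[of l k] by (simp add: algebra_simps)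
  qed simp
  have "Q (Suc m) n = ?f 1 0 + (\<Sum>k\<le>m. ?f (Suc m choose Suc k) (Suc k))"
    unfolding Q_def by (subst sum.atMost_Suc_shift) simp
  also have "(\<Sum>k\<le>m. ?f (Suc m choose Suc k) (Suc k)) = (\<Sum>k\<le>m. ?f (m choose k) (Suc k)) + (\<Sum>k\<le>m. ?f (m choose Suc k) (Suc k))"
    unfolding sum.distrib[symmetric] by (intro sum.cong refl) (simp add: algebra_simps)
  also have "?f 1 0 + (\<dots>) = (\<Sum>k\<le>m. ?f (m choose k) (Suc k)) + (?f (m choose 0) 0 + (\<Sum>k\<le>m. ?f (m choose Suc k) (Suc k)))"
    by (simp add: add_ac)
  also have "?f (m choose 0) 0 + (\<Sum>k\<le>m. ?f (m choose Suc k) (Suc k)) = (\<Sum>k\<le>Suc m. ?f (m choose k) k)"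
    by (subst sum.atMost_Suc_shift) simp
  also have "\<dots> = b * Q m n"
    unfolding Q_def sum_distrib_left sum.atMost_Suc
    by (simp add: binomial_eq_0) (intro sum.cong refl, simp add: Suc_diff_le mult_ac)
  also have "(\<Sum>k\<le>m. ?f (m choose k) (Suc k)) = a * of_nat n * Q m (n - 1)"
    unfolding Q_def sum_distrib_left
  proof (intro sum.cong refl)
    fix k
    have eq: "(m choose k) * ((n choose Suc k) * fact (Suc k)) = n * ((m choose k) * ((n - 1 choose k) * fact k))"
      unfolding ff[symmetric] by simp
    show "?f (m choose k) (Suc k) = a * of_nat n * (of_nat ((m choose k) * ((n - 1 choose k) * fact k)) * a ^ k * b ^ (m - k) * c ^ (n - 1 - k))"
      unfolding eq by (simp only: of_nat_mult power_Suc diff_Suc_Suc diff_diff_left plus_1_eq_Suc mult_ac)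
  qed
  finally show ?thesis .
qed

lemma ambiguity_closed_form:
  fixes x w :: real
  defines "a \<equiv> complex_of_real (4 * pi)"
    and "b \<equiv> - complex_of_real (2 * pi) * (of_real x + \<i> * of_real w)"
    and "c \<equiv> complex_of_real (2 * pi) * (of_real x - \<i> * of_real w)"
  shows "ambiguity m n x w = ambiguity 0 0 x w * (\<Sum>k\<le>m. of_nat ((m choose k) * ((n choose k) * fact k)) *
     a ^ k * b ^ (m - k) * c ^ (n - k))"
proof (induction m arbitrary: n)
  case 0
  show ?case by (subst ambiguity_0_n) (simp add: c_def)
next
  case (Suc m)
  have "ambiguity (Suc m) n x w = a * of_nat n * ambiguity m (n - 1) x w + b * ambiguity m n x w"
    unfolding ambiguity_Suc a_def b_def by simp
  thus ?case unfolding ladder_sum_Suc Suc.IH by (simp only: distrib_left mult_ac)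
qed

lemma ambiguity_diagonal:
  "ambiguity n n x w = ambiguity 0 0 x w * of_real (fact n * (4 * pi) ^ n * laguerre n (pi * (x\<^sup>2 + w\<^sup>2)))"
proof -
  let ?r = "x\<^sup>2 + w\<^sup>2"
  let ?a = "complex_of_real (4 * pi)"
  let ?b = "- complex_of_real (2 * pi) * (of_real x + \<i> * of_real w)"
  let ?c = "complex_of_real (2 * pi) * (of_real x - \<i> * of_real w)"
  have "(\<Sum>k\<le>n. of_nat ((n choose k) * ((n choose k) * fact k)) * ?a ^ k * ?b ^ (n - k) * ?c ^ (n - k))
    = (\<Sum>k\<le>n. of_real (real ((n choose k) * ((n choose k) * fact k)) * (4 * pi) ^ k * (- (4 * pi * (pi * ?r))) ^ (n - k)))"
  proof (intro sum.cong refl)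
    fix k
    have "?b * ?c = of_real (- (4 * pi * (pi * ?r)))"
      by (simp add: complex_eq_iff power2_eq_square algebra_simps)
    hence "?b ^ (n - k) * ?c ^ (n - k) = of_real ((- (4 * pi * (pi * ?r))) ^ (n - k))"
      by (simp only: power_mult_distrib[symmetric] of_real_power)
    thus "of_nat ((n choose k) * ((n choose k) * fact k)) * ?a ^ k * ?b ^ (n - k) * ?c ^ (n - k) =
     of_real (real ((n choose k) * ((n choose k) * fact k)) * (4 * pi) ^ k * (- (4 * pi * (pi * ?r))) ^ (n - k))"
      by (simp only: mult.assoc of_real_mult of_real_power of_real_of_nat_eq of_real_numeral)
  qed
  also have "\<dots> = of_real (\<Sum>k\<le>n. real ((n choose k) * ((n choose k) * fact k)) * (4 * pi) ^ k * (- (4 * pi * (pi * ?r))) ^ (n - k))"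
    by simp
  also have "(\<Sum>k\<le>n. real ((n choose k) * ((n choose k) * fact k)) * (4 * pi) ^ k * (- (4 * pi * (pi * ?r))) ^ (n - k))
    = (\<Sum>k\<le>n. real ((n choose (n - k)) * ((n choose (n - k)) * fact (n - k))) * (4 * pi) ^ (n - k) * (- (4 * pi * (pi * ?r))) ^ (n - (n - k)))"
    by (rule sum.nat_diff_reindex[symmetric, of _ "Suc n", simplified lessThan_Suc_atMost, simplified])
  also have "\<dots> = (\<Sum>j\<le>n. fact n * (4 * pi) ^ n * (of_nat (n choose j) / fact j * (- (pi * ?r)) ^ j))"
  proof (intro sum.cong refl)
    fix j assume "j \<in> {..n}"
    hence j: "j \<le> n" by simp
    have 1: "real (n choose (n - j)) * fact (n - j) = fact n / fact j"
      using binomial_fact[of "n - j" n, where 'a = real] j by simp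
    have "(- (4 * pi * (pi * ?r))) ^ j = (4 * pi) ^ j * (- (pi * ?r)) ^ j"
      by (subst power_mult_distrib[symmetric]) simp
    moreover have "(4 * pi) ^ n = (4 * pi) ^ (n - j) * (4 * pi) ^ j"
      using j by (subst power_add[symmetric]) simp
    ultimately have 2: "(4 * pi) ^ (n - j) * (- (4 * pi * (pi * ?r))) ^ j = (4 * pi) ^ n * (- (pi * ?r)) ^ j"
      by (simp only: mult.assoc)
    have "real ((n choose (n - j)) * ((n choose (n - j)) * fact (n - j))) * (4 * pi) ^ (n - j) * (- (4 * pi * (pi * ?r))) ^ (n - (n - j))
      = real (n choose (n - j)) * (real (n choose (n - j)) * fact (n - j)) * ((4 * pi) ^ (n - j) * (- (4 * pi * (pi * ?r))) ^ j)"
      using j by simp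
    also have "\<dots> = fact n * (4 * pi) ^ n * (of_nat (n choose j) / fact j * (- (pi * ?r)) ^ j)"
      unfolding 1 2 binomial_symmetric[OF j] by simp
    finally show "real ((n choose (n - j)) * ((n choose (n - j)) * fact (n - j))) * (4 * pi) ^ (n - j) * (- (4 * pi * (pi * ?r))) ^ (n - (n - j))
      = fact n * (4 * pi) ^ n * (of_nat (n choose j) / fact j * (- (pi * ?r)) ^ j)" .
  qed
  also have "\<dots> = fact n * (4 * pi) ^ n * laguerre n (pi * ?r)"
    unfolding laguerre_def sum_distrib_left[symmetric] by simp
  finally show ?thesis unfolding ambiguity_closed_form[of n n] by simp
qed

lemma hermite_const_sq: "(hermite_const n)\<^sup>2 = sqrt 2 / (fact n * (4 * pi) ^ n)"
proof -
  have "(2 powr (1/4))\<^sup>2 = (2::real) powr (1/2)"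
    by (simp add: power2_eq_square flip: powr_add)
  moreover have "(2 * pi) ^ n * 2 ^ n = (4 * pi) ^ n"
    by (subst power_mult_distrib[symmetric]) simp
  ultimately show ?thesis
    unfolding hermite_const_def by (simp add: power_divide powr_half_sqrt mult.assoc)
qed

lemma norm_hermite_ambiguity:
  "norm (of_real ((hermite_const n)\<^sup>2) * ambiguity n n x w) =
     \<bar>laguerre n (pi * (x\<^sup>2 + w\<^sup>2))\<bar> * exp (- (pi * (x\<^sup>2 + w\<^sup>2)) / 2)"
proof -
  define K where "K = fact n * (4 * pi) ^ n"
  define L where "L = laguerre n (pi * (x\<^sup>2 + w\<^sup>2))"
  define E where "E = exp (- pi * (x\<^sup>2 + w\<^sup>2) / 2)"
  have pos: "K > 0" "E > 0" by (simp_all add: K_def E_def)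
  have "norm (of_real ((hermite_const n)\<^sup>2) * ambiguity n n x w) = sqrt 2 / K * (E / sqrt 2 * (K * \<bar>L\<bar>))"
    unfolding ambiguity_diagonal[of n] ambiguity_0_0 hermite_const_sq K_def[symmetric] L_def[symmetric] E_def[symmetric]
    using pos by (simp only: norm_mult norm_of_real norm_cis abs_mult abs_divide abs_of_pos real_sqrt_gt_0_iff
        zero_less_numeral mult_1_right)
  also have "\<dots> = \<bar>L\<bar> * E" using pos by simp
  finally show ?thesis by (simp add: L_def E_def)
qed

section \<open>Bounds for the Laguerre function of degree 15\<close>

text \<open>
  The Laguerre polynomial of degree 15, multiplied by \<open>15!\<close> in order to have integer
  coefficients.
\<close>

definition lag15 :: "real poly" where
  "lag15 =
    [:1307674368000, -19615115520000, 68652904320000, -99165306240000, 74373979680000,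
    -32724551059200, 9090153072000, -1669619952000, 208702494000, -18036018000, 1082161080,
    -44717400, 1242150, -22050, 225, -1:]"

lemma coeff_lag15:
  assumes "j \<le> 15"
  shows "coeff lag15 j = fact 15 * of_nat (15 choose j) / fact j * (-1)^j"
proof -
  have j: "j = 0 \<or> j = 1 \<or> j = 2 \<or> j = 3 \<or> j = 4 \<or> j = 5 \<or> j = 6 \<or> j = 7 \<or> j = 8 \<or> j = 9
    \<or> j = 10 \<or> j = 11 \<or> j = 12 \<or> j = 13 \<or> j = 14 \<or> j = 15"
    using assms by presburger
  have "coeff lag15 j = nth_default 0 (coeffs lag15) j"
    by (simp flip: nth_default_coeffs_eq)
  also have "coeffs lag15 =
      [1307674368000, -19615115520000, 68652904320000, -99165306240000, 74373979680000,
      -32724551059200, 9090153072000, -1669619952000, 208702494000, -18036018000, 1082161080,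
      -44717400, 1242150, -22050, 225, -1]"
    by (simp add: lag15_def)
  also have "nth_default 0 \<dots> j = fact 15 * (fact 15 / (fact j * fact (15 - j))) / fact j * (-1)^j"
    using j by (elim disjE) (simp_all add: nth_default_def fact_numeral)
  also have "\<dots> = fact 15 * real (15 choose j) / fact j * (-1)^j"
    using binomial_fact[OF assms, where 'a = real] by simp
  finally show ?thesis .
qed

lemma poly_lag15: "poly lag15 x = fact 15 * laguerre 15 x"
proof -
  have d: "degree lag15 = 15" by (simp add: lag15_def)
  show ?thesis
    unfolding poly_altdef d laguerre_def sum_distrib_left
    by (intro sum.cong refl) (simp add: coeff_lag15 power_minus[of x])
qed

lemma pderiv_lag15: "pderiv lag15 =
    [:-19615115520000, 137305808640000, -297495918720000, 297495918720000, -163622755296000,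
    54540918432000, -11687339664000, 1669619952000, -162324162000, 10821610800, -491891400,
    14905800, -286650, 3150, -15:]"
  by (simp add: lag15_def pderiv_pCons)

lemma lag15_ode:
  "x * poly (pderiv (pderiv lag15)) x + (1 - x) * poly (pderiv lag15) x + 15 * poly lag15 x = 0"
proof -
  have "pderiv (pderiv lag15) =
    [:137305808640000, -594991837440000, 892487756160000, -654491021184000, 272704592160000,
    -70124037984000, 11687339664000, -1298593296000, 97394497200, -4918914000, 163963800,
    -3439800, 40950, -210:]"
    by (simp add: pderiv_lag15 pderiv_pCons)
  hence "[:0,1:] * pderiv (pderiv lag15) + [:1,-1:] * pderiv lag15 + smult 15 lag15 = 0"
    unfolding pderiv_lag15 by (simp add: lag15_def)
  hence "poly ([:0,1:] * pderiv (pderiv lag15) + [:1,-1:] * pderiv lag15 + smult 15 lag15) x = 0"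
    by simp
  thus ?thesis by (simp add: left_diff_distrib)
qed

text \<open>
  Expanding around 56 gives only coefficients of one sign, here and in the next lemma.  So beyond
  56 the Laguerre polynomial is negative, and \<open>L(x) exp (-x/2)\<close> is increasing.  The point 56 is
  chosen to the right of the last critical point of this function, which lies between 55 and 56.
\<close>

lemma lag15_shift: "- poly lag15 (56 + h) = poly
    [:332143196960284849104896, 161906396825173170186240, 35024141705180818068480,
    4511659966092571335680, 389940613752036023040, 24078328631529139968, 1101563720099722880,
    38131730320844160, 1009282531617360, 20463950787280, 315728861448, 3644735640, 30505930,
    174930, 615, 1:] h"
  by (simp add: lag15_def, algebra)

lemma lag15_deriv_shift:
  "2 * poly (pderiv lag15) (56 + h) - poly lag15 (56 + h) = poly
    [:8330403309938508732416, 21809830004449897912320, 7954181908625390054400,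
    1392135056076283151360, 149157327436744623360, 10859563990332465408, 567719495607904640,
    21983209814966400, 640931417446320, 14149373558320, 235544677368, 2912593320, 25957750,
    157710, 585, 1:] h"
  by (simp add: pderiv_lag15, simp add: lag15_def, algebra)

lemma exp_1_ge: "exp (1::real) \<ge> 2.716"
proof -
  have "(2.716::real) \<le> (1 + (1/16) + (1/16)^2/2)^16" by (simp add: power2_eq_square power_divide)
  also have "\<dots> \<le> exp (1/16) ^ 16"
    by (intro power_mono exp_lower_Taylor_quadratic) auto
  also have "\<dots> = exp 1" by (simp flip: exp_of_nat_mult)
  finally show ?thesis .
qed

text \<open>
  Sonin's argument.  With \<open>y(x) = P(x) exp (-x/2)\<close>, Laguerre's equation takes the self-adjoint form
  \<open>(x y')' + (n + 1/2 - x/4) y = 0\<close>, and the function \<open>S\<close> below is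
  \<open>y\<^sup>2 + (x y')\<^sup>2 / (x (n + 1/2 - x/4))\<close>.  It bounds \<open>y\<^sup>2\<close>, and it increases where
  \<open>x (n + 1/2 - x/4)\<close> is positive and decreasing, that is between \<open>2 n + 1\<close> and \<open>4 n + 2\<close>.
\<close>

lemma laguerre_sonin_mono:
  fixes P P1 P2 :: "real \<Rightarrow> real"
  assumes P: "\<And>x. (P has_real_derivative P1 x) (at x)"
    and P1: "\<And>x. (P1 has_real_derivative P2 x) (at x)"
    and ode: "\<And>x. x * P2 x + (1 - x) * P1 x + n * P x = 0"
    and ab: "0 < a" "2 * n + 1 \<le> a" "a \<le> b" "b < 4 * n + 2"
  defines "S \<equiv> \<lambda>x. exp (-x) * ((P x)^2 + 4 * x / (4 * n + 2 - x) * (P1 x - P x / 2)^2)"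
  shows "S a \<le> S b"
proof (rule DERIV_nonneg_imp_nondecreasing[OF ab(3)])
  fix x assume x: "a \<le> x" "x \<le> b"
  define c where "c = 4 * n + 2"
  define D where "D = P1 x - P x / 2"
  have pos: "c - x > 0" "x > 0" using x ab by (auto simp: c_def)
  have dD: "((\<lambda>x. P1 x - P x / 2) has_real_derivative P2 x - P1 x / 2) (at x)"
    by (rule DERIV_diff[OF P1 DERIV_cdivide[OF P]])
  have d1: "((\<lambda>x. 4 * x / (c - x)) has_real_derivative
      ((4 * 1) * (c - x) - 4 * x * (0 - 1)) / ((c - x) * (c - x))) (at x)"
    using pos by (intro DERIV_divide DERIV_cmult DERIV_diff DERIV_const DERIV_ident) auto
  have d2: "((4 * 1) * (c - x) - 4 * x * (0 - 1)) / ((c - x) * (c - x)) = 4 * c / (c - x)^2"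
    by (simp add: power2_eq_square algebra_simps)
  have dR: "((\<lambda>x. 4 * x / (c - x)) has_real_derivative 4 * c / (c - x)^2) (at x)"
    using d1 unfolding d2 .
  have dE: "((\<lambda>x. exp (-x)) has_real_derivative - exp (-x)) (at x)"
    by (rule derivative_eq_intros refl | simp)+
  have s1: "(S has_real_derivative
      (- exp (-x)) * ((P x)^2 + 4 * x / (c - x) * (P1 x - P x / 2)^2) +
      (of_nat 2 * (P1 x * P x ^ (2 - 1)) +
       (4 * c / (c - x)^2 * (P1 x - P x / 2)^2 +
        of_nat 2 * ((P2 x - P1 x / 2) * (P1 x - P x / 2) ^ (2 - 1)) * (4 * x / (c - x)))) * exp (-x)) (at x)"
    unfolding S_def c_def[symmetric]
    using DERIV_mult[OF dE DERIV_add[OF DERIV_power[OF P, of 2] DERIV_mult[OF dR DERIV_power[OF dD, of 2]]]]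
    by (simp add: numeral_2_eq_2)
  have s2: "(- exp (-x)) * ((P x)^2 + 4 * x / (c - x) * (P1 x - P x / 2)^2) +
      (of_nat 2 * (P1 x * P x ^ (2 - 1)) +
       (4 * c / (c - x)^2 * (P1 x - P x / 2)^2 +
        of_nat 2 * ((P2 x - P1 x / 2) * (P1 x - P x / 2) ^ (2 - 1)) * (4 * x / (c - x)))) * exp (-x)
    = exp (-x) * (- ((P x)^2 + 4 * x / (c - x) * D^2) + 2 * P x * P1 x
      + 4 * c / (c - x)^2 * D^2 + 8 * D * (x * P2 x - x * P1 x / 2) / (c - x))"
    unfolding D_def[symmetric] by (simp add: algebra_simps diff_divide_distrib)
  have s3: "- ((P x)^2 + 4 * x / (c - x) * D^2) + 2 * P x * P1 x
      + 4 * c / (c - x)^2 * D^2 + 8 * D * (x * P2 x - x * P1 x / 2) / (c - x)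
      = D^2 * (8 * (x - (2 * n + 1))) / (c - x)^2"
  proof -
    have P1D: "P1 x = D + P x / 2" by (simp add: D_def)
    have "x * P2 x = (x - 1) * P1 x - n * P x"
      using ode[of x] by (simp add: algebra_simps)
    hence "x * P2 x - x * P1 x / 2 = (x/2 - 1) * D - (c - x) / 4 * P x"
      unfolding c_def P1D by (simp add: field_simps)
    moreover have n: "n = (c - 2) / 4" by (simp add: c_def)
    ultimately show ?thesis unfolding n P1D using pos
      by (simp add: divide_simps) algebra
  qed
  show "\<exists>y. (S has_real_derivative y) (at x) \<and> 0 \<le> y"
    using s1 x ab unfolding s2 s3 by (intro exI conjI) auto
qed

lemma lag15_tail_mono:
  assumes "56 \<le> a" "a \<le> b"
  shows "\<bar>poly lag15 b\<bar> * exp (-b/2) \<le> \<bar>poly lag15 a\<bar> * exp (-a/2)"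
proof -
  have neg: "poly lag15 x \<le> 0" if "56 \<le> x" for x
  proof -
    have "- poly lag15 (56 + (x - 56)) \<ge> 0"
      unfolding lag15_shift using that by simp
    thus ?thesis by simp
  qed
  have "poly lag15 a * exp (-a/2) \<le> poly lag15 b * exp (-b/2)"
  proof (rule DERIV_nonneg_imp_nondecreasing[OF assms(2)])
    fix x assume x: "a \<le> x" "x \<le> b"
    have p: "(poly lag15 has_real_derivative poly (pderiv lag15) x) (at x)"
      by (rule poly_DERIV)
    have "((\<lambda>x. poly lag15 x * exp (-x/2)) has_real_derivative
        exp (-x/2) * ((2 * poly (pderiv lag15) x - poly lag15 x) / 2)) (at x)"
      by (rule derivative_eq_intros p refl | simp)+ (simp add: field_simps)
    moreover have "2 * poly (pderiv lag15) (56 + (x - 56)) - poly lag15 (56 + (x - 56)) \<ge> 0"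
      unfolding lag15_deriv_shift using x assms by simp
    ultimately show "\<exists>y. ((\<lambda>x. poly lag15 x * exp (-x/2)) has_real_derivative y) (at x) \<and> 0 \<le> y"
      by (intro exI conjI) auto
  qed
  thus ?thesis using neg[of a] neg[of b] assms by simp
qed

lemma exp_nat_ge: "(2.716::real) ^ n \<le> exp (real n)"
  using power_mono[OF exp_1_ge, of n] by (simp flip: exp_of_nat_mult)

lemma laguerre15_bound_31:
  assumes "31 \<le> x"
  shows "\<bar>laguerre 15 x\<bar> * exp (-x/2) \<le> 19/100"
proof -
  define S where "S = (\<lambda>x. exp (-x) * ((poly lag15 x)^2 +
     4 * x / (62 - x) * (poly (pderiv lag15) x - poly lag15 x / 2)^2))"
  have S56: "S 56 \<le> (19/100 * fact 15)^2"
  proof -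
    have "(poly lag15 56)^2 + 4 * 56 / (62 - 56) * (poly (pderiv lag15) 56 - poly lag15 56 / 2)^2
        \<le> (19/100 * fact 15)^2 * 2.716^56"
      unfolding pderiv_lag15 by (simp add: lag15_def fact_numeral power_divide)
    also have "\<dots> \<le> (19/100 * fact 15)^2 * exp (real 56)"
      by (intro mult_left_mono exp_nat_ge) auto
    finally show ?thesis unfolding S_def by (simp add: exp_minus field_simps)
  qed
  have yS: "(\<bar>poly lag15 x\<bar> * exp (-x/2))^2 \<le> S x" if "31 \<le> x" "x \<le> 56" for x
  proof -
    have "(\<bar>poly lag15 x\<bar> * exp (-x/2))^2 = exp (-x) * (poly lag15 x)^2"
      by (simp add: power_mult_distrib flip: exp_double)
    also have "\<dots> \<le> S x" unfolding S_def using that by (intro mult_left_mono) auto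
    finally show ?thesis .
  qed
  have le: "\<bar>poly lag15 x\<bar> * exp (-x/2) \<le> 19/100 * fact 15" if "31 \<le> x" "x \<le> 56" for x
  proof (rule power2_le_imp_le)
    have "S x \<le> S 56" unfolding S_def
      using laguerre_sonin_mono[where P = "poly lag15" and n = 15 and a = x and b = 56,
          OF poly_DERIV poly_DERIV lag15_ode] that by simp
    thus "(\<bar>poly lag15 x\<bar> * exp (-x/2))^2 \<le> (19/100 * fact 15)^2"
      using yS[OF that] S56 by linarith
  qed auto
  have "\<bar>poly lag15 x\<bar> * exp (-x/2) \<le> 19/100 * fact 15"
  proof (cases "x \<le> 56")
    case False
    thus ?thesis using lag15_tail_mono[of 56 x] le[of 56] by simp
  qed (use le assms in auto)
  hence "fact 15 * (\<bar>laguerre 15 x\<bar> * exp (-x/2)) \<le> fact 15 * (19/100)"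
    unfolding poly_lag15 abs_mult by (simp only: abs_of_pos[OF fact_gt_zero] mult_ac)
  thus ?thesis by (rule mult_left_le_imp_le) (rule fact_gt_zero)
qed

lemma laguerre15_bound_69:
  assumes "69 \<le> x"
  shows "\<bar>laguerre 15 x\<bar> * exp (-x/2) \<le> 4/100"
proof -
  have "(\<bar>poly lag15 69\<bar> * exp (-69/2))^2 = exp (-69) * (poly lag15 69)^2"
    by (simp add: power_mult_distrib flip: exp_double)
  also have "(poly lag15 69)^2 \<le> (4/100 * fact 15)^2 * 2.716^69"
    by (simp add: lag15_def fact_numeral power_divide)
  also have "\<dots> \<le> (4/100 * fact 15)^2 * exp (real 69)"
    by (intro mult_left_mono exp_nat_ge) auto
  finally have "(\<bar>poly lag15 69\<bar> * exp (-69/2))^2 \<le> (4/100 * fact 15)^2"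
    by (simp add: exp_minus field_simps)
  hence "\<bar>poly lag15 69\<bar> * exp (-69/2) \<le> 4/100 * fact 15"
    by (rule power2_le_imp_le) auto
  hence "\<bar>poly lag15 x\<bar> * exp (-x/2) \<le> 4/100 * fact 15"
    using lag15_tail_mono[of 69 x] assms by simp
  hence "fact 15 * (\<bar>laguerre 15 x\<bar> * exp (-x/2)) \<le> fact 15 * (4/100)"
    unfolding poly_lag15 abs_mult by (simp only: abs_of_pos[OF fact_gt_zero] mult_ac)
  thus ?thesis by (rule mult_left_le_imp_le) (rule fact_gt_zero)
qed

text \<open>
  A crude bound for all degrees, from \<open>(x/4)\<^sup>j / j! \<le> exp (x/4)\<close>.
\<close>

lemma laguerre_bound:
  assumes "0 \<le> x"
  shows "\<bar>laguerre n x\<bar> * exp (-x/2) \<le> 5^n * exp (-x/4)"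
proof -
  have "\<bar>laguerre n x\<bar> \<le> (\<Sum>j\<le>n. \<bar>of_nat (n choose j) / fact j * (-x)^j\<bar>)"
    unfolding laguerre_def by (rule sum_abs)
  also have "\<dots> \<le> (\<Sum>j\<le>n. of_nat (n choose j) * 4^j * 1^(n-j) * exp (x/4))"
  proof (rule sum_mono)
    fix j
    have "(x/4)^j / fact j \<le> exp (x/4)"
    proof -
      have "summable (\<lambda>k. (x/4)^k /\<^sub>R fact k)" by (rule summable_exp_generic)
      hence "(\<Sum>k\<in>{j}. (x/4)^k /\<^sub>R fact k) \<le> (\<Sum>k. (x/4)^k /\<^sub>R fact k)"
        using assms by (intro sum_le_suminf) auto
      hence "(x/4)^j /\<^sub>R fact j \<le> exp (x/4)" unfolding exp_def by simp
      moreover have "(x/4)^j /\<^sub>R fact j = (x/4)^j / fact j"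
        by (simp only: real_scaleR_def divide_inverse mult.commute)
      ultimately show ?thesis by simp
    qed
    hence "real (n choose j) * 4^j * ((x/4)^j / fact j) \<le> real (n choose j) * 4^j * exp (x/4)"
      by (intro mult_left_mono) auto
    thus "\<bar>of_nat (n choose j) / fact j * (-x)^j\<bar> \<le> of_nat (n choose j) * 4^j * 1^(n-j) * exp (x/4)"
      using assms by (simp add: abs_mult power_abs power_divide)
  qed
  also have "\<dots> = (4 + 1)^n * exp (x/4)"
    unfolding binomial_ring by (simp add: sum_distrib_right)
  finally have "\<bar>laguerre n x\<bar> * exp (-x/2) \<le> 5^n * exp (x/4) * exp (-x/2)"
    by (intro mult_right_mono) auto
  also have "\<dots> = 5^n * exp (-x/4)"
    by (simp add: mult.assoc flip: exp_add)
  finally show ?thesis .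
qed

section \<open>Parseval's identity for continuous periodic functions\<close>

text \<open>
  The exponential of period \<open>T\<close> and frequency \<open>k / T\<close>.
\<close>

definition trig :: "real \<Rightarrow> int \<Rightarrow> real \<Rightarrow> complex" where
  "trig T k t = cis (2 * pi * of_int k * t / T)"

text \<open>
  The \<open>k\<close>-th Fourier coefficient of a function of period \<open>T\<close>; only its values on \<open>[0, T]\<close> matter.
\<close>

definition fourier_coeff :: "real \<Rightarrow> (real \<Rightarrow> complex) \<Rightarrow> int \<Rightarrow> complex" where
  "fourier_coeff T f k = integral {0..T} (\<lambda>t. f t * trig T (- k) t) / T"

lemma trig_0 [simp]: "trig T 0 t = 1"
  by (simp add: trig_def)

lemma norm_trig [simp]: "norm (trig T k t) = 1"
  by (simp add: trig_def)

lemma trig_mult: "trig T j t * trig T k t = trig T (j + k) t"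
  by (simp add: trig_def cis_mult add_divide_distrib ring_distribs)

lemma cnj_trig: "cnj (trig T k t) = trig T (- k) t"
  by (simp add: trig_def cis_cnj)

lemma continuous_on_trig [continuous_intros]:
  "continuous_on A f \<Longrightarrow> continuous_on A (\<lambda>x. trig T k (f x))"
  unfolding trig_def divide_inverse by (intro continuous_intros)

lemma trig_add_period:
  assumes "T \<noteq> 0"
  shows "trig T k (t + of_int j * T) = trig T k t"
proof -
  have "2 * pi * of_int k * (t + of_int j * T) / T = 2 * pi * of_int k * t / T + 2 * pi * of_int (k * j)"
    using assms by (simp add: field_simps)
  thus ?thesis by (simp add: trig_def cis_mult[symmetric] cis_multiple_2pi)
qed

lemma integral_trig:
  assumes "T > 0"
  shows "integral {0..T} (trig T k) = (if k = 0 then of_real T else 0)"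
proof (cases "k = 0")
  case True
  hence "trig T k = (\<lambda>t. 1)" by auto
  thus ?thesis using assms True by (simp add: scaleR_conv_of_real)
next
  case False
  define c where "c = 2 * pi * of_int k / T"
  have c: "c \<noteq> 0" using assms False by (simp add: c_def)
  have "((\<lambda>t. cis (c * t) / (\<i> * of_real c)) has_vector_derivative trig T k t) (at t within {0..T})" for t
  proof -
    have "((\<lambda>z. exp (\<i> * of_real c * z) / (\<i> * of_real c)) has_field_derivative exp (\<i> * of_real c * of_real t))
        (at (of_real t))"
      by (rule derivative_eq_intros refl | use c in simp)+
    from has_vector_derivative_real_field[OF this] show ?thesis
      by (simp add: cis_conv_exp trig_def c_def mult_ac)
  qed
  hence "(trig T k has_integral cis (c * T) / (\<i> * of_real c) - cis (c * 0) / (\<i> * of_real c)) {0..T}"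
    using assms by (intro fundamental_theorem_of_calculus) auto
  moreover have "cis (c * T) = 1"
    using assms cis_multiple_2pi[of "of_int k"] by (simp add: c_def)
  ultimately show ?thesis using False by (simp add: integral_unique)
qed

lemma fourier_coeff_diff:
  assumes "continuous_on {0..T} f" "continuous_on {0..T} g"
  shows "fourier_coeff T (\<lambda>t. f t - g t) k = fourier_coeff T f k - fourier_coeff T g k"
proof -
  have "integral {0..T} (\<lambda>t. f t * trig T (-k) t - g t * trig T (-k) t)
    = integral {0..T} (\<lambda>t. f t * trig T (-k) t) - integral {0..T} (\<lambda>t. g t * trig T (-k) t)"
    by (intro integral_diff integrable_continuous_interval continuous_intros assms)
  thus ?thesis by (simp add: fourier_coeff_def left_diff_distrib diff_divide_distrib)
qed

lemma fourier_coeff_trig: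
  assumes "T > 0"
  shows "fourier_coeff T (\<lambda>t. d * trig T l t) k = (if k = l then d else 0)"
proof -
  have "(\<lambda>t. d * trig T l t * trig T (-k) t) = (\<lambda>t. d * trig T (l - k) t)"
    by (simp add: mult.assoc trig_mult)
  moreover have "integral {0..T} (trig T (l - k)) = (if l - k = 0 then of_real T else 0)"
    by (rule integral_trig[OF assms])
  ultimately show ?thesis using assms by (simp add: fourier_coeff_def)
qed

lemma fourier_coeff_diff_sum:
  assumes "T > 0" "continuous_on {0..T} f" "finite K"
  shows "fourier_coeff T (\<lambda>t. f t - (\<Sum>l\<in>K. d l * trig T l t)) k = fourier_coeff T f k - (if k \<in> K then d k else 0)"
  using assms(3)
proof (induction K)
  case (insert l K)
  have "fourier_coeff T (\<lambda>t. f t - (\<Sum>l\<in>insert l K. d l * trig T l t)) k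
     = fourier_coeff T (\<lambda>t. (f t - (\<Sum>l\<in>K. d l * trig T l t)) - d l * trig T l t) k"
    using insert.hyps by (simp add: algebra_simps)
  also have "\<dots> = fourier_coeff T (\<lambda>t. f t - (\<Sum>l\<in>K. d l * trig T l t)) k - (if k = l then d l else 0)"
    by (subst fourier_coeff_diff) (intro continuous_intros assms(2), intro continuous_intros, simp add: fourier_coeff_trig assms(1))
  finally show ?case using insert by auto
qed simp

lemma integral_norm_diff_trig:
  assumes "T > 0" and f: "continuous_on {0..T} f"
  shows "integral {0..T} (\<lambda>t. (norm (f t - d * trig T k t))\<^sup>2) =
     integral {0..T} (\<lambda>t. (norm (f t))\<^sup>2) - T * (norm (fourier_coeff T f k))\<^sup>2 + T * (norm (fourier_coeff T f k - d))\<^sup>2"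
proof -
  define c where "c = fourier_coeff T f k"
  have pt: "(norm (f t - d * trig T k t))\<^sup>2 = (norm (f t))\<^sup>2 - 2 * Re (cnj d * (f t * trig T (-k) t)) + (norm d)\<^sup>2" for t
  proof -
    have "Re (cnj d * (f t * trig T (-k) t)) = f t \<bullet> (d * trig T k t)"
      unfolding cnj_trig[symmetric] by (simp add: inner_complex_def algebra_simps)
    moreover have "(norm (f t - d * trig T k t))\<^sup>2 = (norm (f t))\<^sup>2 + (norm (d * trig T k t))\<^sup>2 - 2 * (f t \<bullet> (d * trig T k t))"
      by (simp add: power2_norm_eq_inner inner_diff_left inner_diff_right inner_commute)
    ultimately show ?thesis by (simp add: norm_mult)
  qed
  have i: "(\<lambda>t. f t * trig T (-k) t) integrable_on {0..T}"
    by (intro integrable_continuous_interval continuous_intros f)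
  have "((\<lambda>t. cnj d * (f t * trig T (-k) t)) has_integral cnj d * (T * c)) {0..T}"
    using has_integral_mult_right[OF integrable_integral[OF i], of "cnj d"] assms(1)
    by (simp add: c_def fourier_coeff_def)
  hence re: "((\<lambda>t. Re (cnj d * (f t * trig T (-k) t))) has_integral Re (cnj d * (T * c))) {0..T}"
    by (rule has_integral_linear[OF _ bounded_linear_Re, unfolded o_def])
  have sq: "((\<lambda>t. (norm (f t))\<^sup>2) has_integral integral {0..T} (\<lambda>t. (norm (f t))\<^sup>2)) {0..T}"
    by (intro integrable_integral integrable_continuous_interval continuous_intros f)
  have "((\<lambda>t. (norm d)\<^sup>2) has_integral T * (norm d)\<^sup>2) {0..T}"
    using has_integral_const_real[of "(norm d)\<^sup>2" 0 T] assms(1) by simp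
  from has_integral_add[OF has_integral_diff[OF sq has_integral_mult_right[OF re, of 2]] this]
  have "integral {0..T} (\<lambda>t. (norm (f t - d * trig T k t))\<^sup>2) = integral {0..T} (\<lambda>t. (norm (f t))\<^sup>2) - 2 * Re (cnj d * (T * c)) + T * (norm d)\<^sup>2"
    unfolding pt by (rule integral_unique)
  also have "\<dots> = integral {0..T} (\<lambda>t. (norm (f t))\<^sup>2) - T * (norm c)\<^sup>2 + T * (norm (c - d))\<^sup>2"
    unfolding cmod_power2 by (simp add: power2_eq_square algebra_simps)
  finally show ?thesis unfolding c_def .
qed

text \<open>
  The best approximation property: the distance of \<open>f\<close> to a trigonometric polynomial is smallest
  if the polynomial has the Fourier coefficients of \<open>f\<close>.
\<close>

lemma integral_norm_diff_trig_sum: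
  assumes "T > 0" and f: "continuous_on {0..T} f" and "finite K"
  shows "integral {0..T} (\<lambda>t. (norm (f t - (\<Sum>k\<in>K. d k * trig T k t)))\<^sup>2) =
     integral {0..T} (\<lambda>t. (norm (f t))\<^sup>2) - (\<Sum>k\<in>K. T * (norm (fourier_coeff T f k))\<^sup>2)
     + (\<Sum>k\<in>K. T * (norm (fourier_coeff T f k - d k))\<^sup>2)"
  using assms(3)
proof (induction K)
  case (insert l K)
  let ?g = "\<lambda>t. f t - (\<Sum>k\<in>K. d k * trig T k t)"
  have g: "continuous_on {0..T} ?g" by (intro continuous_intros f)
  have "integral {0..T} (\<lambda>t. (norm (f t - (\<Sum>k\<in>insert l K. d k * trig T k t)))\<^sup>2)
    = integral {0..T} (\<lambda>t. (norm (?g t - d l * trig T l t))\<^sup>2)"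
    using insert.hyps by (simp add: algebra_simps)
  also have "\<dots> = integral {0..T} (\<lambda>t. (norm (?g t))\<^sup>2) - T * (norm (fourier_coeff T f l))\<^sup>2 + T * (norm (fourier_coeff T f l - d l))\<^sup>2"
    using fourier_coeff_diff_sum[OF assms(1) f insert.hyps(1), of d l] insert.hyps(2)
    unfolding integral_norm_diff_trig[OF assms(1) g] by simp
  finally show ?case using insert by simp
qed simp

text \<open>
  Trigonometric polynomials of period \<open>T\<close>, generated in a way suited to proofs that the class is
  closed under products.
\<close>

inductive trig_poly :: "real \<Rightarrow> (real \<Rightarrow> complex) \<Rightarrow> bool" for T where
  monom: "trig_poly T (\<lambda>t. c * trig T k t)"
| add: "trig_poly T p \<Longrightarrow> trig_poly T q \<Longrightarrow> trig_poly T (\<lambda>t. p t + q t)"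

lemma trig_poly_const: "trig_poly T (\<lambda>t. c)"
  using trig_poly.monom[of T c 0] by simp

lemma trig_poly_mult:
  assumes "trig_poly T p" "trig_poly T q"
  shows "trig_poly T (\<lambda>t. p t * q t)"
  using assms(1)
proof induction
  case (monom c k)
  show ?case using assms(2)
  proof induction
    case (monom d l)
    have "(\<lambda>t. c * trig T k t * (d * trig T l t)) = (\<lambda>t. (c * d) * trig T (k + l) t)"
      by (auto simp: trig_mult[symmetric])
    thus ?case by (simp only: trig_poly.monom)
  next
    case (add p q)
    thus ?case using trig_poly.add by (simp add: distrib_left)
  qed
next
  case (add p p')
  thus ?case using trig_poly.add by (simp add: distrib_right)
qed

lemma trig_poly_imp_sum:
  assumes "trig_poly T p"
  obtains K d where "finite K" "p = (\<lambda>t. \<Sum>k\<in>K. d k * trig T k t)"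
proof -
  have "\<exists>K d. finite K \<and> p = (\<lambda>t. \<Sum>k\<in>K. d k * trig T k t)"
    using assms
  proof induction
    case (monom c k)
    show ?case by (intro exI[of _ "{k}"] exI[of _ "\<lambda>_. c"]) simp
  next
    case (add p q)
    then obtain K d L e where K: "finite K" "p = (\<lambda>t. \<Sum>k\<in>K. d k * trig T k t)"
      and L: "finite L" "q = (\<lambda>t. \<Sum>k\<in>L. e k * trig T k t)" by blast
    let ?d = "\<lambda>k. (if k \<in> K then d k else 0) + (if k \<in> L then e k else 0)"
    have "p t + q t = (\<Sum>k\<in>K \<union> L. ?d k * trig T k t)" for t
    proof -
      have "p t = (\<Sum>k\<in>K \<union> L. (if k \<in> K then d k else 0) * trig T k t)"
        unfolding K(2) using K(1) L(1) by (intro sum.mono_neutral_cong_left) auto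
      moreover have "q t = (\<Sum>k\<in>K \<union> L. (if k \<in> L then e k else 0) * trig T k t)"
        unfolding L(2) using K(1) L(1) by (intro sum.mono_neutral_cong_left) auto
      ultimately show ?thesis by (simp add: distrib_right sum.distrib)
    qed
    thus ?case using K(1) L(1) by (intro exI[of _ "K \<union> L"] exI[of _ ?d]) auto
  qed
  thus ?thesis using that by blast
qed

lemma real_polynomial_function_trig_poly:
  assumes "real_polynomial_function r"
  shows "trig_poly T (\<lambda>t. of_real (r (trig T 1 t)))"
  using assms
proof induction
  case (linear f)
  have "of_real (f (trig T 1 t)) = (of_real (f 1) / 2 + of_real (f \<i>) / (2 * \<i>)) * trig T 1 t
      + (of_real (f 1) / 2 - of_real (f \<i>) / (2 * \<i>)) * trig T (-1) t" for t
  proof -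
    let ?z = "trig T 1 t"
    have "f ?z = f (Re ?z *\<^sub>R 1 + Im ?z *\<^sub>R \<i>)"
      by (rule arg_cong[where f = f]) (simp add: complex_eq_iff)
    also have "\<dots> = Re ?z * f 1 + Im ?z * f \<i>"
      using linear by (simp add: bounded_linear.linear linear_add linear_scale)
    finally show ?thesis
      unfolding cnj_trig[symmetric] by (simp add: complex_eq_iff field_simps)
  qed
  thus ?case by (simp only: trig_poly.intros)
next
  case (add f g)
  thus ?case using trig_poly.add by simp
next
  case (mult f g)
  thus ?case using trig_poly_mult by simp
qed (simp add: trig_poly_const)

text \<open>
  A continuous function with \<open>f T = f 0\<close> descends to the unit circle, where the theorem of Stone
  and Weierstrass supplies polynomials in the real and imaginary parts; these are
  trigonometric polynomials of the original variable.
\<close>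

lemma trig_poly_dense:
  assumes T: "T > 0" and f: "continuous_on {0..T} f" "f T = f 0" and e: "e > 0"
  obtains K d where "finite K" "\<And>t. t \<in> {0..T} \<Longrightarrow> norm (f t - (\<Sum>k\<in>K. d k * trig T k t)) < e"
proof -
  \<comment> \<open>Preimages of closed sets under \<open>g\<close> are images of compact subsets of \<open>[0, T]\<close>, so \<open>g\<close> is continuous even where the argument jumps.\<close>
  define g where "g = (\<lambda>z. f (T * Arg2pi z / (2 * pi)))"
  have g: "g (trig T 1 t) = f t" if "t \<in> {0..T}" for t
  proof (cases "t = T")
    case True
    hence "trig T 1 t = 1" using T by (simp add: trig_def)
    moreover have "Arg2pi 1 = 0" by (rule Arg2pi_unique[of 1]) auto
    ultimately show ?thesis using f(2) True by (simp add: g_def)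
  next
    case False
    have "Arg2pi (trig T 1 t) = 2 * pi * t / T"
      by (rule Arg2pi_unique[of 1]) (use that False T in \<open>auto simp: trig_def cis_conv_exp field_simps\<close>)
    thus ?thesis using T by (simp add: g_def)
  qed
  have sph: "sphere 0 1 = trig T 1 ` {0..T}"
  proof (intro subset_antisym subsetI)
    fix z :: complex assume z: "z \<in> sphere 0 1"
    have "T * Arg2pi z / (2 * pi) \<in> {0..T}"
      using T Arg2pi_ge_0[of z] Arg2pi_lt_2pi[of z] by (simp add: divide_le_eq mult_left_mono)
    moreover have "trig T 1 (T * Arg2pi z / (2 * pi)) = z"
      using T z Arg2pi_eq[of z] by (simp add: trig_def cis_conv_exp)
    ultimately show "z \<in> trig T 1 ` {0..T}" by (metis image_eqI)
  qed auto
  have "continuous_on (sphere 0 1) g"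
    unfolding continuous_on_closed_vimage[OF closed_sphere]
  proof (intro allI impI)
    fix B :: "complex set" assume "closed B"
    hence "closed ({0..T} \<inter> f -` B)"
      using f(1) by (simp add: continuous_on_closed_vimage Int_commute)
    hence "compact ({0..T} \<inter> ({0..T} \<inter> f -` B))" by (rule compact_Int_closed[OF compact_Icc])
    hence "compact (trig T 1 ` ({0..T} \<inter> f -` B))"
      by (intro compact_continuous_image continuous_intros) (simp add: Int_assoc[symmetric])
    moreover have "trig T 1 ` ({0..T} \<inter> f -` B) = g -` B \<inter> sphere 0 1"
      unfolding sph using g by auto
    ultimately show "closed (g -` B \<inter> sphere 0 1)" by (simp add: compact_imp_closed)
  qed
  from Stone_Weierstrass_polynomial_function[OF compact_sphere this e]
  obtain q where q: "polynomial_function q" "\<And>z. z \<in> sphere 0 1 \<Longrightarrow> norm (g z - q z) < e" by blast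
  have "real_polynomial_function (Re \<circ> q)" "real_polynomial_function (Im \<circ> q)"
    using q(1) bounded_linear_Re bounded_linear_Im unfolding polynomial_function_def by blast+
  hence "trig_poly T (\<lambda>t. of_real ((Re \<circ> q) (trig T 1 t)) + \<i> * of_real ((Im \<circ> q) (trig T 1 t)))"
    by (intro trig_poly.add trig_poly_mult trig_poly_const real_polynomial_function_trig_poly)
  also have "(\<lambda>t. of_real ((Re \<circ> q) (trig T 1 t)) + \<i> * of_real ((Im \<circ> q) (trig T 1 t))) = (\<lambda>t. q (trig T 1 t))"
    by (auto simp: complex_eq_iff)
  finally obtain K d where K: "finite K" "(\<lambda>t. q (trig T 1 t)) = (\<lambda>t. \<Sum>k\<in>K. d k * trig T k t)"
    by (rule trig_poly_imp_sum)
  show ?thesis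
  proof (rule that[OF K(1)])
    fix t assume t: "t \<in> {0..T}"
    have "norm (g (trig T 1 t) - q (trig T 1 t)) < e"
      by (rule q(2)) simp
    thus "norm (f t - (\<Sum>k\<in>K. d k * trig T k t)) < e"
      using g[OF t] fun_cong[OF K(2), of t] by simp
  qed
qed

theorem parseval:
  assumes T: "T > 0" and f: "continuous_on {0..T} f" "f T = f 0"
  shows "((\<lambda>k. T * (norm (fourier_coeff T f k))\<^sup>2) has_sum integral {0..T} (\<lambda>t. (norm (f t))\<^sup>2)) UNIV"
  unfolding has_sum_def tendsto_iff eventually_finite_subsets_at_top
proof (intro allI impI)
  fix e :: real assume e: "e > 0"
  \<comment> \<open>Uniform approximation within \<open>r\<close> costs at most \<open>T r\<^sup>2 = e / 2\<close> in the integral.\<close>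
  define r where "r = sqrt (e / (2 * T))"
  have r: "r > 0" "T * r\<^sup>2 = e / 2" using e T by (auto simp: r_def)
  obtain K d where K: "finite K" "\<And>t. t \<in> {0..T} \<Longrightarrow> norm (f t - (\<Sum>k\<in>K. d k * trig T k t)) < r"
    using trig_poly_dense[OF T f r(1)] by blast
  let ?I = "integral {0..T} (\<lambda>t. (norm (f t))\<^sup>2)"
  let ?c = "fourier_coeff T f"
  have bessel: "(\<Sum>k\<in>L. T * (norm (?c k))\<^sup>2) \<le> ?I" if "finite L" for L
  proof -
    have "0 \<le> integral {0..T} (\<lambda>t. (norm (f t - (\<Sum>k\<in>L. ?c k * trig T k t)))\<^sup>2)"
      by (intro integral_nonneg integrable_continuous_interval continuous_intros f) auto
    thus ?thesis unfolding integral_norm_diff_trig_sum[OF T f(1) that] by simp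
  qed
  have low: "?I - e / 2 \<le> (\<Sum>k\<in>L. T * (norm (?c k))\<^sup>2)" if L: "finite L" "K \<subseteq> L" for L
  proof -
    have "integral {0..T} (\<lambda>t. (norm (f t - (\<Sum>k\<in>K. d k * trig T k t)))\<^sup>2) \<le> integral {0..T} (\<lambda>t. r\<^sup>2)"
      using K(2) by (intro integral_le integrable_continuous_interval continuous_intros f power_mono) (auto intro: less_imp_le)
    also have "\<dots> = e / 2" using T r(2) by simp
    finally have "?I - (\<Sum>k\<in>K. T * (norm (?c k))\<^sup>2) + (\<Sum>k\<in>K. T * (norm (?c k - d k))\<^sup>2) \<le> e / 2"
      unfolding integral_norm_diff_trig_sum[OF T f(1) K(1)] .
    moreover have "0 \<le> (\<Sum>k\<in>K. T * (norm (?c k - d k))\<^sup>2)" using T by (intro sum_nonneg) auto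
    moreover have "(\<Sum>k\<in>K. T * (norm (?c k))\<^sup>2) \<le> (\<Sum>k\<in>L. T * (norm (?c k))\<^sup>2)"
      using L T by (intro sum_mono2) auto
    ultimately show ?thesis by linarith
  qed
  show "\<exists>X. finite X \<and> X \<subseteq> UNIV \<and> (\<forall>Y. finite Y \<and> X \<subseteq> Y \<and> Y \<subseteq> UNIV \<longrightarrow>
      dist (\<Sum>k\<in>Y. T * (norm (?c k))\<^sup>2) ?I < e)"
  proof (intro exI[of _ K] conjI allI impI K(1) subset_UNIV)
    fix Y assume Y: "finite Y \<and> K \<subseteq> Y \<and> Y \<subseteq> UNIV"
    show "dist (\<Sum>k\<in>Y. T * (norm (?c k))\<^sup>2) ?I < e"
      using bessel[of Y] low[of Y] Y e unfolding dist_real_def by linarith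
  qed
qed

section \<open>Pointwise Fourier series and periodization\<close>

lemma fourier_coeff_uniform_limit:
  assumes "T > 0" "uniform_limit {0..T} g f (finite_subsets_at_top A)"
    and "\<And>X. continuous_on {0..T} (g X)"
  shows "((\<lambda>X. fourier_coeff T (g X) k) \<longlongrightarrow> fourier_coeff T f k) (finite_subsets_at_top A)"
proof -
  have f: "continuous_on {0..T} f"
    by (rule uniform_limit_theorem[OF _ assms(2)]) (use assms(3) in auto)
  have "bounded (f ` {0..T})" "bounded (trig T (-k) ` {0..T})"
    by (intro compact_imp_bounded compact_continuous_image compact_Icc f continuous_intros)+
  hence ul: "uniform_limit {0..T} (\<lambda>X t. g X t * trig T (-k) t) (\<lambda>t. f t * trig T (-k) t) (finite_subsets_at_top A)"
    by (intro uniform_lim_mult assms(2) uniform_limit_const)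
  have cont: "continuous_on {0..T} (\<lambda>t. g X t * trig T (-k) t)" for X
    by (intro continuous_intros assms(3))
  obtain I J where IJ: "\<And>X. ((\<lambda>t. g X t * trig T (-k) t) has_integral I X) {0..T}"
    "((\<lambda>t. f t * trig T (-k) t) has_integral J) {0..T}" "(I \<longlongrightarrow> J) (finite_subsets_at_top A)"
    by (rule uniform_limit_integral[OF ul cont finite_subsets_at_top_neq_bot]) blast
  have "((\<lambda>X. I X / of_real T) \<longlongrightarrow> J / of_real T) (finite_subsets_at_top A)"
    using assms(1) by (intro tendsto_divide IJ(3) tendsto_const) simp
  thus ?thesis
    unfolding fourier_coeff_def integral_unique[OF IJ(1)] integral_unique[OF IJ(2)] .
qed

lemma periodic_int:
  fixes f :: "real \<Rightarrow> 'a"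
  assumes "\<And>t. f (t + T) = f t"
  shows "f (t + of_int j * T) = f t"
proof (induction j rule: int_induct[of _ 0])
  case (step1 i)
  thus ?case using assms[of "t + of_int i * T"] by (simp add: algebra_simps)
next
  case (step2 i)
  thus ?case using assms[of "t + of_int (i - 1) * T"] by (simp add: algebra_simps)
qed simp

lemma periodic_reduce:
  fixes t T :: real
  assumes "T > 0"
  obtains j where "t + of_int j * T \<in> {0..T}"
proof -
  have "of_int \<lfloor>t / T\<rfloor> * T \<le> t" "t \<le> (of_int \<lfloor>t / T\<rfloor> + 1) * T"
    using of_int_floor_le[of "t / T"] real_of_int_floor_add_one_ge[of "t / T"]
    unfolding pos_le_divide_eq[OF assms] pos_divide_le_eq[OF assms] .
  hence "t + of_int (- \<lfloor>t / T\<rfloor>) * T \<in> {0..T}" by (simp add: algebra_simps)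
  thus ?thesis by (rule that)
qed

text \<open>
  The series converges uniformly to a continuous function with the same Fourier coefficients,
  and by Parseval's identity these determine a continuous function.
\<close>

theorem fourier_series_has_sum:
  assumes T: "T > 0" and f: "continuous_on {0..T} f" "\<And>t. f (t + T) = f t"
    and sum: "(\<lambda>k. norm (fourier_coeff T f k)) summable_on UNIV"
  shows "((\<lambda>k. fourier_coeff T f k * trig T k t) has_sum f t) UNIV"
proof -
  let ?c = "fourier_coeff T f"
  define g where "g = (\<lambda>t. \<Sum>\<^sub>\<infinity>k. ?c k * trig T k t)"
  have hs: "((\<lambda>k. ?c k * trig T k t) has_sum g t) UNIV" for t
    unfolding g_def
    by (rule has_sum_infsum, rule abs_summable_summable) (use sum in \<open>simp add: norm_mult\<close>)
  have ul: "uniform_limit {0..T} (\<lambda>X t. \<Sum>k\<in>X. ?c k * trig T k t) g (finite_subsets_at_top UNIV)"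
    unfolding g_def using sum by (intro Weierstrass_m_test_general) (auto simp: norm_mult)
  have g: "continuous_on {0..T} g"
    by (rule uniform_limit_theorem[OF _ ul]) (auto intro!: always_eventually continuous_intros)
  have gper: "g (t + of_int j * T) = g t" for t j
    unfolding g_def using T by (simp add: trig_add_period)
  have coeff: "fourier_coeff T g k = ?c k" for k
  proof -
    have "((\<lambda>X. fourier_coeff T (\<lambda>t. \<Sum>k\<in>X. ?c k * trig T k t) k) \<longlongrightarrow> fourier_coeff T g k) (finite_subsets_at_top UNIV)"
      by (rule fourier_coeff_uniform_limit[OF T ul]) (intro continuous_intros)
    moreover have "\<forall>\<^sub>F X in finite_subsets_at_top UNIV. fourier_coeff T (\<lambda>t. \<Sum>k\<in>X. ?c k * trig T k t) k = ?c k"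
      unfolding eventually_finite_subsets_at_top
    proof (intro exI[of _ "{k}"] conjI allI impI)
      fix X assume X: "finite X \<and> {k} \<subseteq> X \<and> X \<subseteq> UNIV"
      have "fourier_coeff T (\<lambda>t. 0 - (\<Sum>k\<in>X. - ?c k * trig T k t)) k = ?c k"
        using fourier_coeff_diff_sum[of T "\<lambda>_. 0" X "\<lambda>k. - ?c k" k] X T by (simp add: fourier_coeff_def)
      thus "fourier_coeff T (\<lambda>t. \<Sum>k\<in>X. ?c k * trig T k t) k = ?c k"
        by (simp add: sum_negf)
    qed auto
    ultimately have "((\<lambda>X. ?c k) \<longlongrightarrow> fourier_coeff T g k) (finite_subsets_at_top (UNIV :: int set))"
      by (rule Lim_transform_eventually)
    thus ?thesis using tendsto_unique[OF _ _ tendsto_const] by (metis finite_subsets_at_top_neq_bot)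
  qed
  have fg: "continuous_on {0..T} (\<lambda>t. f t - g t)" by (intro continuous_intros f g)
  have "((\<lambda>k. T * (norm (fourier_coeff T (\<lambda>t. f t - g t) k))\<^sup>2) has_sum integral {0..T} (\<lambda>t. (norm (f t - g t))\<^sup>2)) UNIV"
    using parseval[OF T fg] f(2)[of 0] gper[of 0 1] by simp
  hence "integral {0..T} (\<lambda>t. (norm (f t - g t))\<^sup>2) = 0"
    unfolding fourier_coeff_diff[OF f(1) g] coeff using has_sum_unique[OF _ has_sum_0] by fastforce
  hence eq: "f t = g t" if "t \<in> {0..T}" for t
    using that T by (subst (asm) integral_eq_0_iff) (auto intro!: continuous_intros fg)
  obtain j where "t + of_int j * T \<in> {0..T}" using periodic_reduce[OF T] by blast
  from eq[OF this] have "f t = g t" unfolding gper periodic_int[where f = f, OF f(2)] .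
  thus ?thesis using hs by simp
qed

lemma summable_on_inverse_square_int: "(\<lambda>j::int. C / (1 + (of_int j)\<^sup>2) :: real) summable_on UNIV"
proof -
  have "summable (\<lambda>n. norm (1 / (1 + (real n)\<^sup>2)))"
  proof (rule summable_comparison_test_ev[OF _ inverse_power_summable[of 2, where 'a = real]])
    show "\<forall>\<^sub>F n in sequentially. norm (norm (1 / (1 + (real n)\<^sup>2))) \<le> inverse (real n ^ 2)"
      using eventually_gt_at_top[of 0] by eventually_elim (simp add: field_simps add_pos_nonneg)
  qed simp
  hence n: "(\<lambda>n::nat. 1 / (1 + (real n)\<^sup>2)) summable_on UNIV"
    by (rule norm_summable_imp_summable_on)
  let ?f = "\<lambda>j::int. 1 / (1 + (of_int j)\<^sup>2) :: real"
  have "?f summable_on range int"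
    by (subst summable_on_reindex) (use n in \<open>auto simp: o_def inj_on_def\<close>)
  moreover have "?f summable_on range (\<lambda>n. - int n)"
    by (subst summable_on_reindex) (use n in \<open>auto simp: o_def inj_on_def\<close>)
  hence "?f summable_on (range (\<lambda>n. - int n) - range int)"
    by (rule summable_on_subset_banach) auto
  ultimately have "?f summable_on (range int \<union> (range (\<lambda>n. - int n) - range int))"
    by (intro summable_on_Un_disjoint) auto
  also have "range int \<union> (range (\<lambda>n. - int n) - range int) = UNIV"
  proof -
    have "j \<in> range int \<union> range (\<lambda>n. - int n)" for j by (cases j rule: int_cases2) auto
    thus ?thesis by auto
  qed
  finally have "(\<lambda>j. C * ?f j) summable_on UNIV" by (rule summable_on_cmult_right)
  thus ?thesis by simp
qed

text \<open>
  The sum of all translates of \<open>u\<close> by multiples of \<open>T\<close>.  It is 0 at points where the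
  sum diverges; this does not happen for functions of quadratic decay.
\<close>

definition periodization :: "real \<Rightarrow> (real \<Rightarrow> complex) \<Rightarrow> real \<Rightarrow> complex" where
  "periodization T u t = (\<Sum>\<^sub>\<infinity>j::int. u (t + of_int j * T))"

text \<open>
  A summable majorant for the translates, uniform on bounded intervals.
\<close>

lemma quadratic_decay_translates:
  fixes u :: "real \<Rightarrow> complex"
  assumes "T > 0" and u: "\<And>t. norm (u t) \<le> C / (1 + t\<^sup>2)"
  shows "\<exists>D. \<forall>j. \<forall>t\<in>{-R..R}. norm (u (t + of_int j * T)) \<le> D / (1 + (of_int j)\<^sup>2)"
proof (intro exI allI ballI)
  fix j :: int and t assume t: "t \<in> {-R..R}"
  define s where "s = t + of_int j * T"
  have C: "C \<ge> 0" using order_trans[OF norm_ge_zero u[of 0]] by simp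
  have "t\<^sup>2 \<le> R\<^sup>2" using t by (intro power2_le_iff_abs_le[THEN iffD2]) auto
  moreover have "(of_int j * T)\<^sup>2 \<le> 2 * s\<^sup>2 + 2 * t\<^sup>2"
    using zero_le_power2[of "s + t"] by (simp add: s_def power2_eq_square algebra_simps)
  moreover have "2 * s\<^sup>2 + 2 * R\<^sup>2 + 1 \<le> (2 + 2 * R\<^sup>2) * (1 + s\<^sup>2)"
    by (simp add: algebra_simps)
  ultimately have 1: "1 + (of_int j * T)\<^sup>2 \<le> (2 + 2 * R\<^sup>2) * (1 + s\<^sup>2)" by linarith
  have "1 + (of_int j)\<^sup>2 \<le> (1 + 1 / T\<^sup>2) * (1 + (of_int j * T)\<^sup>2)"
    using assms(1) by (simp add: field_simps power_mult_distrib)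
  also have "\<dots> \<le> (1 + 1 / T\<^sup>2) * ((2 + 2 * R\<^sup>2) * (1 + s\<^sup>2))"
    by (intro mult_left_mono 1) auto
  finally have 2: "1 + (of_int j)\<^sup>2 \<le> (1 + 1 / T\<^sup>2) * (2 + 2 * R\<^sup>2) * (1 + s\<^sup>2)" by (simp only: mult.assoc)
  have p: "1 + s\<^sup>2 > 0" "1 + (real_of_int j)\<^sup>2 > 0" by (simp_all add: add_pos_nonneg)
  have "C * (1 + (of_int j)\<^sup>2) \<le> C * ((1 + 1 / T\<^sup>2) * (2 + 2 * R\<^sup>2) * (1 + s\<^sup>2))"
    using C 2 by (intro mult_left_mono)
  hence "C / (1 + s\<^sup>2) \<le> (C * ((1 + 1 / T\<^sup>2) * (2 + 2 * R\<^sup>2))) / (1 + (of_int j)\<^sup>2)"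
    using p by (subst frac_le_eq) (auto simp: divide_le_0_iff algebra_simps)
  thus "norm (u (t + of_int j * T)) \<le> (C * ((1 + 1 / T\<^sup>2) * (2 + 2 * R\<^sup>2))) / (1 + (of_int j)\<^sup>2)"
    using u[of s] unfolding s_def by linarith
qed

context
  fixes T C :: real and u :: "real \<Rightarrow> complex"
  assumes T: "T > 0" and u: "continuous_on UNIV u" and decay: "\<And>t. norm (u t) \<le> C / (1 + t\<^sup>2)"
begin

lemma periodization_uniform_limit:
  "uniform_limit {-R..R} (\<lambda>X t. \<Sum>j\<in>X. u (t + of_int j * T)) (periodization T u) (finite_subsets_at_top UNIV)"
proof -
  obtain D where D: "\<And>j t. t \<in> {-R..R} \<Longrightarrow> norm (u (t + of_int j * T)) \<le> D / (1 + (of_int j)\<^sup>2)"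
    using quadratic_decay_translates[OF T decay] by blast
  show ?thesis unfolding periodization_def
    by (rule Weierstrass_m_test_general[where M = "\<lambda>j. D / (1 + (of_int j)\<^sup>2)", OF D summable_on_inverse_square_int])
qed

lemma continuous_on_translates: "continuous_on A (\<lambda>t. u (t + c))"
  by (rule continuous_on_compose2[OF u]) (auto intro!: continuous_intros)

lemma continuous_on_periodization: "continuous_on A (periodization T u)"
proof -
  have "isCont (periodization T u) t" for t
  proof -
    have "continuous_on {-(\<bar>t\<bar> + 1)..\<bar>t\<bar> + 1} (periodization T u)"
      by (rule uniform_limit_theorem[OF _ periodization_uniform_limit])
         (auto intro!: always_eventually continuous_on_sum continuous_on_translates)
    thus ?thesis by (rule continuous_on_interior) auto
  qed
  thus ?thesis by (simp add: continuous_at_imp_continuous_on)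
qed

lemma periodization_periodic: "periodization T u (t + T) = periodization T u t"
proof -
  have "periodization T u t = (\<Sum>\<^sub>\<infinity>j. u (t + of_int (j + 1) * T))"
    unfolding periodization_def
    by (rule infsum_reindex_bij_betw[symmetric]) (rule bij_betwI[of _ _ _ "\<lambda>j. j - 1"], auto)
  thus ?thesis unfolding periodization_def by (simp add: algebra_simps)
qed

lemma integral_translates_sum:
  "(\<Sum>j\<in>{- int n..<int n}. integral {0..T} (\<lambda>t. u (t + of_int j * T))) = integral {- (n * T)..n * T} u"
proof (induction n)
  case (Suc n)
  have i: "u integrable_on {a..b}" for a b
    by (intro integrable_continuous_interval continuous_on_subset[OF u]) simp
  have tr: "integral {0..T} (\<lambda>t. u (t + of_int j * T)) = integral {of_int j * T..(of_int j + 1) * T} u" for j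
    using integral_shift_real_ivl[of "of_int j * T" "of_int j * T" "(of_int j + 1) * T" u] by (simp add: algebra_simps)
  have nT: "0 \<le> real n * T" "real n * T \<le> real (Suc n) * T" using T by simp_all
  define F where "F = (\<lambda>j. integral {0..T} (\<lambda>t. u (t + of_int j * T)))"
  have "{- int (Suc n)..<int (Suc n)} = insert (- int n - 1) (insert (int n) {- int n..<int n})" by auto
  hence "sum F {- int (Suc n)..<int (Suc n)} = F (- int n - 1) + F (int n) + sum F {- int n..<int n}"
    by simp
  also have "F (- int n - 1) = integral {- (Suc n * T)..- (n * T)} u"
  proof -
    have "of_int (- int n - 1) * T = - (Suc n * T)" "(of_int (- int n - 1) + 1) * T = - (n * T)"
      by (simp_all add: algebra_simps)
    thus ?thesis unfolding F_def tr by (simp only:)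
  qed
  also have "F (int n) = integral {n * T..Suc n * T} u"
    unfolding F_def tr by (simp add: algebra_simps)
  also have "sum F {- int n..<int n} = integral {- (n * T)..n * T} u"
    unfolding F_def by (rule Suc.IH)
  also have "integral {- (Suc n * T)..- (n * T)} u + integral {n * T..Suc n * T} u + integral {- (n * T)..n * T} u
    = (integral {- (Suc n * T)..- (n * T)} u + integral {- (n * T)..n * T} u) + integral {n * T..Suc n * T} u"
    by simp
  also have "integral {- (Suc n * T)..- (n * T)} u + integral {- (n * T)..n * T} u = integral {- (Suc n * T)..n * T} u"
    by (intro Henstock_Kurzweil_Integration.integral_combine i) (use nT in linarith)+
  also have "integral {- (Suc n * T)..n * T} u + integral {n * T..Suc n * T} u = integral {- (Suc n * T)..Suc n * T} u"
    by (intro Henstock_Kurzweil_Integration.integral_combine i) (use nT in linarith)+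
  finally show ?case unfolding F_def .
qed simp

lemma integral_symmetric_tendsto: "(\<lambda>n. integral {- (real n * T)..real n * T} u) \<longlonglongrightarrow> (LINT t|lborel. u t)"
proof -
  have int: "integrable lborel u" by (rule integrable_quadratic_decay[OF u decay])
  hence si: "set_integrable lborel {a..b} u" for a b
    unfolding set_integrable_def by (intro integrable_mult_indicator) auto
  have "(\<lambda>n. LINT t|lborel. indicator {- (real n * T)..real n * T} t *\<^sub>R u t) \<longlonglongrightarrow> (LINT t|lborel. u t)"
  proof (rule integral_dominated_convergence[where w = "\<lambda>t. norm (u t)"])
    show "AE t in lborel. (\<lambda>n. indicator {- (real n * T)..real n * T} t *\<^sub>R u t) \<longlonglongrightarrow> u t"
    proof (rule AE_I2, rule tendsto_eventually)
      fix t :: real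
      have "filterlim (\<lambda>n. real n * T) at_top sequentially"
        using T by (intro filterlim_at_top_mult_tendsto_pos[OF tendsto_const]) (auto simp: filterlim_real_sequentially)
      hence "\<forall>\<^sub>F n in sequentially. \<bar>t\<bar> \<le> real n * T" by (simp add: filterlim_at_top)
      thus "\<forall>\<^sub>F n in sequentially. indicator {- (real n * T)..real n * T} t *\<^sub>R u t = u t"
        by eventually_elim (auto simp: indicator_def)
    qed
  qed (use int in \<open>auto split: split_indicator\<close>)
  thus ?thesis
    using set_borel_integral_eq_integral(2)[OF si] by (simp add: set_lebesgue_integral_def)
qed

lemma integral_periodization: "integral {0..T} (periodization T u) = (LINT t|lborel. u t)"
proof -
  have ul: "uniform_limit {0..T} (\<lambda>X t. \<Sum>j\<in>X. u (t + of_int j * T)) (periodization T u) (finite_subsets_at_top UNIV)"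
    by (rule uniform_limit_on_subset[OF periodization_uniform_limit[of T]]) (use T in auto)
  have cont: "continuous_on {0..T} (\<lambda>t. \<Sum>j\<in>X. u (t + of_int j * T))" for X
    by (intro continuous_on_sum continuous_on_translates)
  obtain I J where IJ: "\<And>X. ((\<lambda>t. \<Sum>j\<in>X. u (t + of_int j * T)) has_integral I X) {0..T}"
    "(periodization T u has_integral J) {0..T}" "(I \<longlongrightarrow> J) (finite_subsets_at_top UNIV)"
    by (rule uniform_limit_integral[OF ul cont finite_subsets_at_top_neq_bot]) blast
  have I: "I {- int n..<int n} = integral {- (real n * T)..real n * T} u" for n
    unfolding integral_translates_sum[symmetric] integral_unique[OF IJ(1), symmetric]
    by (intro integral_sum integrable_continuous_interval continuous_on_translates) auto
  have "filterlim (\<lambda>n. {- int n..<int n}) (finite_subsets_at_top UNIV) sequentially"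
    unfolding filterlim_finite_subsets_at_top
  proof (intro allI impI)
    fix X :: "int set" assume "finite X \<and> X \<subseteq> UNIV"
    then obtain m where m: "\<And>x. x \<in> X \<Longrightarrow> \<bar>x\<bar> \<le> m"
      using that[of "Max (abs ` X)"] Max_ge[of "abs ` X"] by auto
    show "\<forall>\<^sub>F n in sequentially. finite {- int n..<int n} \<and> X \<subseteq> {- int n..<int n} \<and> {- int n..<int n} \<subseteq> UNIV"
      using eventually_gt_at_top[of "nat m"] by eventually_elim (use m in force)
  qed
  from filterlim_compose[OF IJ(3) this] have "(\<lambda>n. integral {- (real n * T)..real n * T} u) \<longlonglongrightarrow> J"
    unfolding I .
  hence "J = (LINT t|lborel. u t)" by (rule LIMSEQ_unique[OF _ integral_symmetric_tendsto])
  thus ?thesis using IJ(2) by (simp add: integral_unique)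
qed

end

text \<open>
  The Fourier coefficients of a periodization are samples of the Fourier transform.
\<close>

lemma fourier_coeff_periodization:
  assumes T: "T > 0" and u: "continuous_on UNIV u" and decay: "\<And>t. norm (u t) \<le> C / (1 + t\<^sup>2)"
  shows "fourier_coeff T (periodization T u) k = (LINT t|lborel. u t * trig T (- k) t) / T"
proof -
  let ?v = "\<lambda>t. u t * trig T (- k) t"
  have v: "continuous_on UNIV ?v" by (intro continuous_intros u)
  have "periodization T ?v t = periodization T u t * trig T (- k) t" for t
    using T unfolding periodization_def by (simp add: trig_add_period infsum_cmult_left')
  hence "integral {0..T} (\<lambda>t. periodization T u t * trig T (- k) t) = integral {0..T} (periodization T ?v)"
    by (intro arg_cong[where f = "integral {0..T}"] ext) simp
  also have "\<dots> = (LINT t|lborel. ?v t)"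
    by (rule integral_periodization[OF T v, of C]) (use decay in \<open>simp add: norm_mult\<close>)
  finally show ?thesis by (simp add: fourier_coeff_def)
qed

section \<open>Square-integrable functions and compactly supported approximation\<close>

text \<open>
  The squared \<open>L\<^sup>2\<close> norm.
\<close>

definition energy :: "(real \<Rightarrow> complex) \<Rightarrow> real" where
  "energy f = (LINT t|lebesgue. (norm (f t))\<^sup>2)"

lemma energy_nonneg: "energy f \<ge> 0"
  unfolding energy_def by (rule integral_nonneg_AE) simp

lemma L2_norm_sq: "(L2_norm f)\<^sup>2 = energy f"
  using energy_nonneg[of f] by (simp add: L2_norm_def energy_def)

lemma L2_measurable: "f \<in> L2 \<Longrightarrow> f \<in> borel_measurable lebesgue"
  and L2_integrable: "f \<in> L2 \<Longrightarrow> integrable lebesgue (\<lambda>t. (norm (f t))\<^sup>2)"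
  by (simp_all add: L2_def)

lemma norm_add_sq_le:
  fixes a b :: complex
  assumes "r > 0"
  shows "(norm (a + b))\<^sup>2 \<le> (1 + r) * (norm a)\<^sup>2 + (1 + 1/r) * (norm b)\<^sup>2"
proof -
  have "0 \<le> (r * norm a - norm b)\<^sup>2 / r" using assms by simp
  also have "\<dots> = r * (norm a)\<^sup>2 - 2 * norm a * norm b + (norm b)\<^sup>2 / r"
    using assms by (simp add: power2_eq_square field_simps)
  finally have "2 * norm a * norm b \<le> r * (norm a)\<^sup>2 + (norm b)\<^sup>2 / r" by simp
  moreover have "(norm (a + b))\<^sup>2 \<le> (norm a + norm b)\<^sup>2"
    by (intro power_mono norm_triangle_ineq) auto
  ultimately show ?thesis by (simp add: power2_sum algebra_simps)
qed

lemma L2_add: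
  assumes "f \<in> L2" "g \<in> L2"
  shows "(\<lambda>t. f t + g t) \<in> L2"
proof -
  have [measurable]: "f \<in> borel_measurable lebesgue" "g \<in> borel_measurable lebesgue"
    using assms L2_measurable by auto
  have "integrable lebesgue (\<lambda>t. (norm (f t + g t))\<^sup>2)"
  proof (rule Bochner_Integration.integrable_bound)
    show "integrable lebesgue (\<lambda>t. (1 + 1) * (norm (f t))\<^sup>2 + (1 + 1/1) * (norm (g t))\<^sup>2)"
      by (intro Bochner_Integration.integrable_add integrable_mult_right L2_integrable assms)
    show "AE t in lebesgue. norm ((norm (f t + g t))\<^sup>2) \<le> norm ((1 + 1) * (norm (f t))\<^sup>2 + (1 + 1/1) * (norm (g t))\<^sup>2)"
      using norm_add_sq_le[of 1] by (intro AE_I2) (simp add: abs_of_nonneg)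
  qed measurable
  thus ?thesis by (simp add: L2_def)
qed

lemma L2_uminus: "f \<in> L2 \<Longrightarrow> (\<lambda>t. - f t) \<in> L2"
  by (simp add: L2_def)

lemma L2_diff: "f \<in> L2 \<Longrightarrow> g \<in> L2 \<Longrightarrow> (\<lambda>t. f t - g t) \<in> L2"
  using L2_add[OF _ L2_uminus] by simp

lemma energy_minus_commute: "energy (\<lambda>t. f t - g t) = energy (\<lambda>t. g t - f t)"
  by (simp add: energy_def norm_minus_commute)

lemma energy_add_le:
  assumes "f \<in> L2" "g \<in> L2" "r > 0"
  shows "energy (\<lambda>t. f t + g t) \<le> (1 + r) * energy f + (1 + 1/r) * energy g"
proof -
  have "energy (\<lambda>t. f t + g t) \<le> (LINT t|lebesgue. (1 + r) * (norm (f t))\<^sup>2 + (1 + 1/r) * (norm (g t))\<^sup>2)"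
    unfolding energy_def
    by (intro integral_mono L2_integrable L2_add assms Bochner_Integration.integrable_add integrable_mult_right norm_add_sq_le)
  also have "\<dots> = (1 + r) * energy f + (1 + 1/r) * energy g"
    unfolding energy_def using assms by (subst Bochner_Integration.integral_add) (auto intro: L2_integrable)
  finally show ?thesis .
qed

lemma L2_prod_integrable:
  assumes "f \<in> L2" "g \<in> L2"
  shows "integrable lebesgue (\<lambda>t. f t * cnj (g t))"
proof (rule Bochner_Integration.integrable_bound)
  have [measurable]: "f \<in> borel_measurable lebesgue" "g \<in> borel_measurable lebesgue"
    using assms L2_measurable by auto
  show "integrable lebesgue (\<lambda>t. (norm (f t))\<^sup>2 + (norm (g t))\<^sup>2)"
    by (intro Bochner_Integration.integrable_add L2_integrable assms)
  have "(\<lambda>t. cnj (g t)) \<in> borel_measurable lebesgue"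
    by (rule measurable_compose[OF _ borel_measurable_continuous_onI]) (auto intro: continuous_intros)
  thus "(\<lambda>t. f t * cnj (g t)) \<in> borel_measurable lebesgue" by simp
  have "norm (f t * cnj (g t)) \<le> (norm (f t))\<^sup>2 + (norm (g t))\<^sup>2" for t
  proof -
    have "0 \<le> norm (f t) * norm (g t)" by simp
    moreover have "2 * (norm (f t) * norm (g t)) \<le> (norm (f t))\<^sup>2 + (norm (g t))\<^sup>2"
      using sum_squares_bound[of "norm (f t)" "norm (g t)"] by simp
    ultimately show ?thesis unfolding norm_mult complex_mod_cnj by linarith
  qed
  thus "AE t in lebesgue. norm (f t * cnj (g t)) \<le> norm ((norm (f t))\<^sup>2 + (norm (g t))\<^sup>2)"
    by (intro AE_I2) (simp add: abs_of_nonneg)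
qed

lemma L2_inner_diff:
  assumes "f \<in> L2" "g \<in> L2" "h \<in> L2"
  shows "L2_inner (\<lambda>t. f t - g t) h = L2_inner f h - L2_inner g h"
  unfolding L2_inner_def left_diff_distrib
  by (intro Bochner_Integration.integral_diff L2_prod_integrable assms)

lemma L2_Cauchy_Schwarz:
  assumes "f \<in> L2" "g \<in> L2"
  shows "(norm (L2_inner f g))\<^sup>2 \<le> energy f * energy g"
proof -
  define x where "x = norm (L2_inner f g)"
  have le: "2 * x \<le> r * energy f + energy g / r" if r: "r > 0" for r
  proof -
    have "2 * x \<le> 2 * (LINT t|lebesgue. norm (f t * cnj (g t)))"
      unfolding x_def L2_inner_def by (intro mult_left_mono integral_norm_bound) auto
    also have "\<dots> = (LINT t|lebesgue. 2 * norm (f t * cnj (g t)))" by simp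
    also have "\<dots> \<le> (LINT t|lebesgue. r * (norm (f t))\<^sup>2 + (norm (g t))\<^sup>2 / r)"
    proof (rule integral_mono)
      show "integrable lebesgue (\<lambda>t. 2 * norm (f t * cnj (g t)))"
        by (intro integrable_mult_right integrable_norm L2_prod_integrable assms)
      show "integrable lebesgue (\<lambda>t. r * (norm (f t))\<^sup>2 + (norm (g t))\<^sup>2 / r)"
        using r by (intro Bochner_Integration.integrable_add integrable_mult_right integrable_divide L2_integrable assms)
      fix t
      have "0 \<le> (r * norm (f t) - norm (g t))\<^sup>2 / r" using r by simp
      also have "\<dots> = r * (norm (f t))\<^sup>2 + (norm (g t))\<^sup>2 / r - 2 * norm (f t * cnj (g t))"
        using r by (simp add: power2_eq_square field_simps norm_mult)
      finally show "2 * norm (f t * cnj (g t)) \<le> r * (norm (f t))\<^sup>2 + (norm (g t))\<^sup>2 / r" by simp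
    qed
    also have "\<dots> = r * energy f + energy g / r"
      unfolding energy_def using r assms
      by (subst Bochner_Integration.integral_add) (auto intro: L2_integrable)
    finally show ?thesis .
  qed
  have nn: "energy f \<ge> 0" "energy g \<ge> 0" "x \<ge> 0" by (auto simp: energy_nonneg x_def)
  \<comment> \<open>Choose the weight \<open>r\<close> that balances the two terms, or a large one if \<open>f\<close> vanishes almost everywhere.\<close>
  have "x\<^sup>2 \<le> energy f * energy g"
  proof (cases "x = 0")
    case False
    hence x: "x > 0" using nn by simp
    show ?thesis
    proof (cases "energy f = 0")
      case True
      have "2 * x \<le> energy g / ((energy g + 1) / x)"
        using le[of "(energy g + 1) / x"] True x nn by simp
      also have "\<dots> \<le> x" using x nn by (simp add: field_simps)
      finally show ?thesis using x by simp
    next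
      case False
      hence "energy f > 0" using nn by simp
      thus ?thesis using le[of "x / energy f"] x by (simp add: field_simps power2_eq_square)
    qed
  qed (use nn in simp)
  thus ?thesis by (simp add: x_def)
qed

text \<open>
  The continuous functions on the line that vanish outside a bounded interval.
\<close>

definition compactly_supported :: "(real \<Rightarrow> complex) set" where
  "compactly_supported = {f. continuous_on UNIV f \<and> (\<exists>R. \<forall>t. \<bar>t\<bar> > R \<longrightarrow> f t = 0)}"

lemma bounded_compact_support_L2:
  assumes f: "f \<in> borel_measurable lebesgue" and b: "\<And>t. norm (f t) \<le> B" and R: "\<And>t. \<bar>t\<bar> > R \<Longrightarrow> f t = 0"
  shows "f \<in> L2"
proof -
  have "integrable lebesgue (\<lambda>t. indicator {-R..R} t *\<^sub>R B\<^sup>2)"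
    by (intro integrable_scaleR_left integrable_real_indicator) (auto simp: emeasure_lborel_Icc_eq)
  hence "integrable lebesgue (\<lambda>t. (norm (f t))\<^sup>2)"
  proof (rule Bochner_Integration.integrable_bound)
    show "AE t in lebesgue. norm ((norm (f t))\<^sup>2) \<le> norm (indicator {-R..R} t *\<^sub>R B\<^sup>2)"
      using b R by (intro AE_I2) (auto simp: indicator_def intro!: power_mono)
    show "(\<lambda>t. (norm (f t))\<^sup>2) \<in> borel_measurable lebesgue" using f by measurable
  qed
  thus ?thesis using f by (simp add: L2_def)
qed

lemma compactly_supported_bounded:
  assumes "f \<in> compactly_supported"
  obtains B where "B > 0" "\<And>t. norm (f t) \<le> B"
proof -
  obtain R where R: "\<And>t. \<bar>t\<bar> > R \<Longrightarrow> f t = 0" and c: "continuous_on UNIV f"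
    using assms by (auto simp: compactly_supported_def)
  have "bounded (f ` {-R..R})"
    by (intro compact_imp_bounded compact_continuous_image compact_Icc continuous_on_subset[OF c]) simp
  then obtain B where B: "B > 0" "\<And>t. t \<in> {-R..R} \<Longrightarrow> norm (f t) \<le> B"
    by (auto simp: bounded_pos)
  have "norm (f t) \<le> B" for t
    using B(1) B(2)[of t] R[of t] by (cases "\<bar>t\<bar> > R") (auto simp: not_less abs_le_iff)
  thus ?thesis using that B(1) by blast
qed

lemma compactly_supported_L2: "f \<in> compactly_supported \<Longrightarrow> f \<in> L2"
proof -
  assume f: "f \<in> compactly_supported"
  obtain B where B: "\<And>t. norm (f t) \<le> B" using compactly_supported_bounded[OF f] by blast
  obtain R where R: "\<And>t. \<bar>t\<bar> > R \<Longrightarrow> f t = 0" and c: "continuous_on UNIV f"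
    using f by (auto simp: compactly_supported_def)
  have "f \<in> borel_measurable lebesgue"
    using borel_measurable_continuous_onI[OF c] by (simp add: measurable_completion)
  thus ?thesis using B R by (rule bounded_compact_support_L2)
qed

lemma energy_tendsto_0:
  assumes h: "\<And>n. h n \<in> borel_measurable lebesgue"
    and lim: "AE t in lebesgue. (\<lambda>n. h n t) \<longlonglongrightarrow> 0"
    and w: "integrable lebesgue w" "\<And>n t. (norm (h n t))\<^sup>2 \<le> w t"
  shows "(\<lambda>n. energy (h n)) \<longlonglongrightarrow> 0"
proof -
  have "(\<lambda>n. energy (h n)) \<longlonglongrightarrow> integral\<^sup>L lebesgue (\<lambda>t::real. 0)"
    unfolding energy_def
  proof (rule integral_dominated_convergence[where w = w])
    show "AE t in lebesgue. (\<lambda>n. (norm (h n t))\<^sup>2) \<longlonglongrightarrow> 0"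
      using lim by eventually_elim (auto intro!: tendsto_eq_intros)
    show "(\<lambda>t. (norm (h n t))\<^sup>2) \<in> borel_measurable lebesgue" for n
      using h[of n] by measurable
  qed (use w in auto)
  thus ?thesis by simp
qed

lemma truncation_dense:
  assumes f: "f \<in> L2" and e: "e > 0"
  obtains h n where "h \<in> borel_measurable lebesgue" "n > 0" "\<And>t. norm (h t) \<le> real n"
    "\<And>t. \<bar>t\<bar> > real n \<Longrightarrow> h t = 0" "energy (\<lambda>t. f t - h t) < e"
proof -
  have [measurable]: "f \<in> borel_measurable lebesgue" by (rule L2_measurable[OF f])
  define h where "h = (\<lambda>n t. if norm (f t) \<le> real n \<and> \<bar>t\<bar> \<le> real n then f t else 0)"
  have [measurable]: "(\<lambda>t::real. \<bar>t\<bar>) \<in> borel_measurable lebesgue"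
    by (rule measurable_completion) simp
  have hm[measurable]: "h n \<in> borel_measurable lebesgue" for n
    unfolding h_def by measurable
  have "(\<lambda>n. energy (\<lambda>t. f t - h n t)) \<longlonglongrightarrow> 0"
  proof (rule energy_tendsto_0[OF _ _ L2_integrable[OF f]])
    show "AE t in lebesgue. (\<lambda>n. f t - h n t) \<longlonglongrightarrow> 0"
    proof (rule AE_I2, rule tendsto_eventually)
      fix t
      have "\<forall>\<^sub>F n in sequentially. max (norm (f t)) \<bar>t\<bar> \<le> real n"
        using filterlim_real_sequentially unfolding filterlim_at_top by blast
      thus "\<forall>\<^sub>F n in sequentially. f t - h n t = 0"
        by eventually_elim (simp add: h_def)
    qed
  qed (auto simp: h_def)
  hence "\<forall>\<^sub>F n in sequentially. energy (\<lambda>t. f t - h n t) < e"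
    using e by (rule order_tendstoD)
  hence "\<forall>\<^sub>F n in sequentially. energy (\<lambda>t. f t - h n t) < e \<and> n > 0"
    using eventually_gt_at_top by (rule eventually_conj)
  then obtain n where n: "energy (\<lambda>t. f t - h n t) < e" "n > 0"
    by (auto simp: eventually_sequentially)
  show ?thesis by (rule that[OF hm n(2) _ _ n(1)]) (auto simp: h_def)
qed

text \<open>
  A bounded function of bounded support is an almost everywhere limit of continuous functions.
  These are clipped to the same bound and multiplied by a cut-off function, so that
  dominated convergence applies.
\<close>

lemma compactly_supported_approx_bounded:
  assumes h: "h \<in> borel_measurable lebesgue" "\<And>t. norm (h t) \<le> B" "\<And>t. \<bar>t\<bar> > R \<Longrightarrow> h t = 0"
    and B: "B > 0" and e: "e > 0"
  obtains g where "g \<in> compactly_supported" "energy (\<lambda>t. h t - g t) < e"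
proof -
  have "h measurable_on UNIV"
    using h(1) by (subst measurable_on_iff_borel_measurable) auto
  then obtain N G where N: "negligible N" "\<And>n. continuous_on UNIV (G n)"
    "\<And>t. t \<notin> N \<Longrightarrow> (\<lambda>n. G n t) \<longlonglongrightarrow> h t"
    unfolding measurable_on_def by auto
  define clip where "clip = (\<lambda>z::complex. z /\<^sub>R max 1 (norm z / B))"
  define cut where "cut = (\<lambda>t::real. max 0 (min 1 (R + 1 - \<bar>t\<bar>)))"
  define g where "g = (\<lambda>n t. cut t *\<^sub>R clip (G n t))"
  have clip_cont: "continuous_on UNIV clip"
    unfolding clip_def using B by (intro continuous_intros) (auto simp: max_def split: if_splits)
  have clip_le: "norm (clip z) \<le> B" for z
    using B by (auto simp: clip_def max_def field_simps)
  have cut: "0 \<le> cut t" "cut t \<le> 1" "\<bar>t\<bar> > R + 1 \<Longrightarrow> cut t = 0" "\<bar>t\<bar> \<le> R \<Longrightarrow> cut t = 1" for t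
    by (auto simp: cut_def)
  have g_cont: "continuous_on UNIV (g n)" for n
    unfolding g_def cut_def
    by (intro continuous_intros continuous_on_compose2[OF clip_cont N(2)]) auto
  have g_le: "norm (g n t) \<le> B" for n t
  proof -
    have "norm (g n t) \<le> 1 * B"
      unfolding g_def norm_scaleR by (intro mult_mono clip_le) (use cut[of t] in auto)
    thus ?thesis by simp
  qed
  have g_cs: "g n \<in> compactly_supported" for n
    unfolding compactly_supported_def using g_cont cut(3) by (auto simp: g_def intro!: exI[of _ "R + 1"])
  have [measurable]: "g n \<in> borel_measurable lebesgue" for n
    by (rule L2_measurable[OF compactly_supported_L2[OF g_cs]])
  have "(\<lambda>n. energy (\<lambda>t. h t - g n t)) \<longlonglongrightarrow> 0"
  proof (rule energy_tendsto_0[where w = "\<lambda>t. indicator {-(R+1)..R+1} t *\<^sub>R (2 * B)\<^sup>2"])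
    show "AE t in lebesgue. (\<lambda>n. h t - g n t) \<longlonglongrightarrow> 0"
    proof (rule AE_I')
      show "N \<in> null_sets lebesgue" using N(1) by (simp add: negligible_iff_null_sets)
      have "(\<lambda>n. h t - g n t) \<longlonglongrightarrow> 0" if "t \<notin> N" for t
      proof -
        have "(\<lambda>n. h t - cut t *\<^sub>R clip (G n t)) \<longlonglongrightarrow> h t - cut t *\<^sub>R clip (h t)"
          by (intro tendsto_intros continuous_on_tendsto_compose[OF clip_cont N(3)[OF that]]) auto
        moreover have "clip (h t) = h t"
          using h(2)[of t] B by (simp add: clip_def max_def)
        hence "cut t *\<^sub>R clip (h t) = h t" using cut(4)[of t] h(3)[of t] by (cases "\<bar>t\<bar> \<le> R") auto
        ultimately show ?thesis by (simp add: g_def)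
      qed
      thus "{t \<in> space lebesgue. \<not> (\<lambda>n. h t - g n t) \<longlonglongrightarrow> 0} \<subseteq> N" by blast
    qed
    show "integrable lebesgue (\<lambda>t. indicator {-(R+1)..R+1} t *\<^sub>R (2 * B)\<^sup>2)"
      by (intro integrable_scaleR_left integrable_real_indicator) (auto simp: emeasure_lborel_Icc_eq)
    fix n t
    show "(norm (h t - g n t))\<^sup>2 \<le> indicator {-(R+1)..R+1} t *\<^sub>R (2 * B)\<^sup>2"
    proof (cases "\<bar>t\<bar> \<le> R + 1")
      case True
      have "norm (h t - g n t) \<le> 2 * B"
        using norm_triangle_ineq4[of "h t" "g n t"] h(2)[of t] g_le[of n t] by linarith
      hence "(norm (h t - g n t))\<^sup>2 \<le> (2 * B)\<^sup>2" by (intro power_mono) auto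
      thus ?thesis using True by (auto simp: indicator_def)
    next
      case False
      thus ?thesis using cut(3)[of t] h(3)[of t] by (simp add: g_def)
    qed
  qed (use h(1) in measurable)
  hence "\<forall>\<^sub>F n in sequentially. energy (\<lambda>t. h t - g n t) < e"
    using e by (rule order_tendstoD)
  thus ?thesis using that[OF g_cs] by (auto simp: eventually_sequentially)
qed

theorem compactly_supported_dense:
  assumes f: "f \<in> L2" and e: "e > 0"
  obtains g where "g \<in> compactly_supported" "energy (\<lambda>t. f t - g t) < e"
proof -
  have e4: "e / 4 > 0" using e by simp
  obtain h n where h: "h \<in> borel_measurable lebesgue" "n > 0" "\<And>t. norm (h t) \<le> real n"
    "\<And>t. \<bar>t\<bar> > real n \<Longrightarrow> h t = 0" "energy (\<lambda>t. f t - h t) < e / 4"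
    using truncation_dense[OF f e4] by blast
  have hL: "h \<in> L2" using h(1,3,4) by (rule bounded_compact_support_L2)
  obtain g where g: "g \<in> compactly_supported" "energy (\<lambda>t. h t - g t) < e / 4"
    using compactly_supported_approx_bounded[OF h(1,3,4) _ e4] h(2) by auto
  have "energy (\<lambda>t. (f t - h t) + (h t - g t)) \<le> (1 + 1) * energy (\<lambda>t. f t - h t) + (1 + 1/1) * energy (\<lambda>t. h t - g t)"
    by (intro energy_add_le L2_diff f hL compactly_supported_L2 g) simp
  hence "energy (\<lambda>t. f t - g t) < e" using h(5) g(2) by simp
  thus ?thesis using that g(1) by blast
qed

text \<open>
  Absorbs the arbitrarily small parameter of the weighted inequality \<open>norm_add_sq_le\<close>.
\<close>

lemma le_of_right_limit:
  fixes p :: "real \<Rightarrow> real"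
  assumes "\<And>r. r > 0 \<Longrightarrow> x \<le> p r" "continuous_on UNIV p"
  shows "x \<le> p 0"
proof (rule tendsto_lowerbound[where F = "at_right 0"])
  show "(p \<longlongrightarrow> p 0) (at_right 0)"
    using assms(2) by (auto simp: continuous_on_def intro: tendsto_within_subset)
  show "\<forall>\<^sub>F r in at_right 0. x \<le> p r"
    using assms(1) by (auto simp: eventually_at_filter)
qed simp

text \<open>
  The upper bound extends first, one finite subfamily at a time.  It then controls the
  coefficients of \<open>f - g\<close> for \<open>g\<close> close to \<open>f\<close>, which is what the lower bound needs.
\<close>

theorem L2_frame_from_dense:
  assumes \<phi>: "\<And>i. i \<in> I \<Longrightarrow> \<phi> i \<in> L2" and AB: "0 < A" "A \<le> B"
    and sum: "\<And>g. g \<in> compactly_supported \<Longrightarrow> (\<lambda>i. (norm (L2_inner g (\<phi> i)))\<^sup>2) summable_on I"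
    and lower: "\<And>g. g \<in> compactly_supported \<Longrightarrow> A * energy g \<le> (\<Sum>\<^sub>\<infinity>i\<in>I. (norm (L2_inner g (\<phi> i)))\<^sup>2)"
    and upper: "\<And>g. g \<in> compactly_supported \<Longrightarrow> (\<Sum>\<^sub>\<infinity>i\<in>I. (norm (L2_inner g (\<phi> i)))\<^sup>2) \<le> B * energy g"
  shows "L2_frame I \<phi>"
proof -
  let ?S = "\<lambda>f i. (norm (L2_inner f (\<phi> i)))\<^sup>2"
  have split: "?S f i \<le> (1 + r) * ?S g i + (1 + 1/r) * ?S (\<lambda>t. f t - g t) i"
    if "f \<in> L2" "g \<in> L2" "i \<in> I" "r > 0" for f g i r
    using norm_add_sq_le[OF that(4), of "L2_inner g (\<phi> i)" "L2_inner f (\<phi> i) - L2_inner g (\<phi> i)"]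
      L2_inner_diff[OF that(1,2) \<phi>[OF that(3)]] by simp
  have approx: "\<exists>g\<in>compactly_supported. energy (\<lambda>t. f t - g t) \<le> r\<^sup>2" if "f \<in> L2" "r > 0" for f r
    using compactly_supported_dense[OF that(1), of "r\<^sup>2"] that(2) by (metis less_imp_le zero_less_power)
  have step: "(1 + 1/r) * d \<le> r + r\<^sup>2" if "d \<le> r\<^sup>2" "r > 0" for r d :: real
  proof -
    have "(1 + 1/r) * d \<le> (1 + 1/r) * r\<^sup>2" using that by (intro mult_left_mono) auto
    also have "\<dots> = r + r\<^sup>2" using that by (simp add: field_simps power2_eq_square)
    finally show ?thesis .
  qed
  have finite_bessel: "sum (?S f) F \<le> B * energy f" if f: "f \<in> L2" and F: "finite F" "F \<subseteq> I" for f F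
  proof -
    define K where "K = (\<Sum>i\<in>F. energy (\<phi> i))"
    have K: "K \<ge> 0" unfolding K_def by (intro sum_nonneg energy_nonneg)
    have B0: "B \<ge> 0" using AB by simp
    \<comment> \<open>Here \<open>r\<close> is both the weight in \<open>norm_add_sq_le\<close> and a bound for the distance from \<open>f\<close> to its approximation \<open>g\<close>.\<close>
    have "sum (?S f) F \<le> (1 + r) * (B * ((1 + r) * energy f + (r + r\<^sup>2))) + (r + r\<^sup>2) * K" if r: "r > 0" for r
    proof -
      obtain g where g: "g \<in> compactly_supported" "energy (\<lambda>t. f t - g t) \<le> r\<^sup>2"
        using approx[OF f r] by blast
      have gL: "g \<in> L2" by (rule compactly_supported_L2[OF g(1)])
      let ?d = "energy (\<lambda>t. f t - g t)"
      have "sum (?S f) F \<le> (\<Sum>i\<in>F. (1 + r) * ?S g i + (1 + 1/r) * (?d * energy (\<phi> i)))"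
      proof (rule sum_mono)
        fix i assume i: "i \<in> F"
        have "?S (\<lambda>t. f t - g t) i \<le> ?d * energy (\<phi> i)"
          using i F by (intro L2_Cauchy_Schwarz L2_diff f gL \<phi>) auto
        hence "(1 + 1/r) * ?S (\<lambda>t. f t - g t) i \<le> (1 + 1/r) * (?d * energy (\<phi> i))"
          using r by (intro mult_left_mono) auto
        moreover have "?S f i \<le> (1 + r) * ?S g i + (1 + 1/r) * ?S (\<lambda>t. f t - g t) i"
          using i F by (intro split f gL r) auto
        ultimately show "?S f i \<le> (1 + r) * ?S g i + (1 + 1/r) * (?d * energy (\<phi> i))" by linarith
      qed
      also have "\<dots> = (1 + r) * sum (?S g) F + ((1 + 1/r) * ?d) * K"
        by (simp add: sum.distrib sum_distrib_left K_def mult.assoc)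
      also have "\<dots> \<le> (1 + r) * (B * ((1 + r) * energy f + (r + r\<^sup>2))) + (r + r\<^sup>2) * K"
      proof (intro add_mono mult_left_mono mult_right_mono step[OF g(2) r] K)
        have "sum (?S g) F \<le> (\<Sum>\<^sub>\<infinity>i\<in>I. ?S g i)"
          using F by (intro finite_sum_le_infsum sum g) auto
        also have "\<dots> \<le> B * energy g" by (rule upper[OF g(1)])
        also have "energy g \<le> (1 + r) * energy f + (r + r\<^sup>2)"
          using energy_add_le[OF f L2_diff[OF gL f] r] step[OF g(2) r] energy_minus_commute[of g f] by simp
        finally show "sum (?S g) F \<le> B * ((1 + r) * energy f + (r + r\<^sup>2))" using B0 by (simp add: mult_left_mono)
      qed (use r in auto)
      finally show ?thesis .
    qed
    moreover have "continuous_on UNIV (\<lambda>r. (1 + r) * (B * ((1 + r) * energy f + (r + r\<^sup>2))) + (r + r\<^sup>2) * K)"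
      by (intro continuous_intros)
    ultimately have "sum (?S f) F \<le> (\<lambda>r. (1 + r) * (B * ((1 + r) * energy f + (r + r\<^sup>2))) + (r + r\<^sup>2) * K) 0"
      by (rule le_of_right_limit)
    thus ?thesis by simp
  qed
  have summable: "?S f summable_on I" if "f \<in> L2" for f
    by (rule nonneg_bdd_above_summable_on) (auto simp: bdd_above_def intro!: exI[of _ "B * energy f"] finite_bessel that)
  have bessel: "infsum (?S f) I \<le> B * energy f" if "f \<in> L2" for f
    by (rule infsum_le_finite_sums[OF summable finite_bessel]) (use that in auto)
  have low: "A * energy f \<le> infsum (?S f) I" if f: "f \<in> L2" for f
  proof -
    let ?X = "infsum (?S f) I"
    have "A * energy f \<le> (1 + r) * ((1 + r) * ?X + (r + r\<^sup>2) * B) + A * (r + r\<^sup>2)" if r: "r > 0" for r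
    proof -
      obtain g where g: "g \<in> compactly_supported" "energy (\<lambda>t. f t - g t) \<le> r\<^sup>2"
        using approx[OF f r] by blast
      have gL: "g \<in> L2" by (rule compactly_supported_L2[OF g(1)])
      let ?h = "\<lambda>t. g t - f t"
      have h: "?h \<in> L2" "energy ?h \<le> r\<^sup>2" using L2_diff[OF gL f] g(2) energy_minus_commute[of g f] by auto
      have "A * energy g \<le> infsum (?S g) I" by (rule lower[OF g(1)])
      also have "\<dots> \<le> (\<Sum>\<^sub>\<infinity>i\<in>I. (1 + r) * ?S f i + (1 + 1/r) * ?S ?h i)"
        by (intro infsum_mono summable gL f h summable_on_add summable_on_cmult_right split r)
      also have "\<dots> = (1 + r) * ?X + (1 + 1/r) * infsum (?S ?h) I"
        using summable[OF f] summable[OF h(1)]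
        by (subst infsum_add) (auto intro: summable_on_cmult_right simp: infsum_cmult_right)
      also have "(1 + 1/r) * infsum (?S ?h) I \<le> (1 + 1/r) * (B * energy ?h)"
        using r by (intro mult_left_mono bessel h) auto
      also have "\<dots> = (1 + 1/r) * energy ?h * B" by simp
      also have "\<dots> \<le> (r + r\<^sup>2) * B"
        using AB by (intro mult_right_mono step h r) auto
      finally have "A * energy g \<le> (1 + r) * ?X + (r + r\<^sup>2) * B" by simp
      hence "(1 + r) * (A * energy g) \<le> (1 + r) * ((1 + r) * ?X + (r + r\<^sup>2) * B)"
        using r by (intro mult_left_mono) auto
      moreover have "energy f \<le> (1 + r) * energy g + (r + r\<^sup>2)"
        using energy_add_le[OF gL L2_diff[OF f gL] r] step[OF g(2) r] by simp
      hence "A * energy f \<le> A * ((1 + r) * energy g + (r + r\<^sup>2))"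
        using AB by (intro mult_left_mono) auto
      ultimately show ?thesis by (simp add: algebra_simps)
    qed
    moreover have "continuous_on UNIV (\<lambda>r. (1 + r) * ((1 + r) * ?X + (r + r\<^sup>2) * B) + A * (r + r\<^sup>2))"
      by (intro continuous_intros)
    ultimately have "A * energy f \<le> (\<lambda>r. (1 + r) * ((1 + r) * ?X + (r + r\<^sup>2) * B) + A * (r + r\<^sup>2)) 0"
      by (rule le_of_right_limit)
    thus ?thesis by simp
  qed
  show ?thesis
    unfolding L2_frame_def L2_norm_sq using \<phi> AB summable low bessel by blast
qed

section \<open>The dual lattice expansion of the Gabor frame operator\<close>

lemma compact_support_decay:
  fixes u :: "real \<Rightarrow> complex"
  assumes c: "continuous_on UNIV u" and R: "\<And>t. \<bar>t\<bar> > R \<Longrightarrow> u t = 0"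
  shows "\<exists>C. \<forall>t. norm (u t) \<le> C / (1 + t\<^sup>2)"
proof -
  have "u \<in> compactly_supported" using c R by (auto simp: compactly_supported_def)
  then obtain B where B: "B > 0" "\<And>t. norm (u t) \<le> B"
    using compactly_supported_bounded by blast
  have "norm (u t) \<le> (B * (1 + R\<^sup>2)) / (1 + t\<^sup>2)" for t
  proof (cases "\<bar>t\<bar> > R")
    case True
    thus ?thesis using R[of t] B(1) by simp
  next
    case False
    hence "t\<^sup>2 \<le> R\<^sup>2" by (intro power2_le_iff_abs_le[THEN iffD2]) auto
    hence "norm (u t) * (1 + t\<^sup>2) \<le> B * (1 + R\<^sup>2)"
      using B by (intro mult_mono) auto
    thus ?thesis by (simp add: pos_le_divide_eq add_pos_nonneg)
  qed
  thus ?thesis by blast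
qed

lemma periodization_compact_support:
  assumes T: "T > 0" and R: "\<And>t. \<bar>t\<bar> > R \<Longrightarrow> u t = 0" "2 * R \<le> real n * T" and t: "\<bar>t\<bar> \<le> R"
  shows "periodization T u t = (\<Sum>j\<in>{- int n..int n}. u (t + of_int j * T))"
proof -
  have "((\<lambda>j. u (t + of_int j * T)) has_sum (\<Sum>j\<in>{- int n..int n}. u (t + of_int j * T))) UNIV"
  proof (rule has_sum_finite_neutralI[OF _ _ _ refl])
    fix j assume "j \<in> UNIV - {- int n..int n}"
    hence "\<bar>j\<bar> \<ge> int n + 1" by auto
    hence "real n + 1 \<le> of_int \<bar>j\<bar>" by linarith
    hence "(real n + 1) * T \<le> \<bar>of_int j * T\<bar>"
      using T by (simp add: abs_mult)
    hence "\<bar>t + of_int j * T\<bar> > R" using R(2) t T by (simp add: distrib_right)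
    thus "u (t + of_int j * T) = 0" by (rule R(1))
  qed auto
  thus ?thesis unfolding periodization_def by (rule infsumI)
qed

text \<open>
  Unfolding one factor of \<open>\<bar>periodization T u\<bar>\<^sup>2\<close> turns the integral over a period into an
  integral over the line; compact support leaves finitely many terms in the other factor.
\<close>

lemma integral_norm_periodization_sq:
  fixes u :: "real \<Rightarrow> complex"
  assumes T: "T > 0" and u: "continuous_on UNIV u" and R: "\<And>t. \<bar>t\<bar> > R \<Longrightarrow> u t = 0" "2 * R \<le> real n * T"
  shows "complex_of_real (integral {0..T} (\<lambda>t. (norm (periodization T u t))\<^sup>2)) =
    (\<Sum>j\<in>{- int n..int n}. LINT t|lborel. u t * cnj (u (t + of_int j * T)))"
proof -
  obtain C where C: "\<And>t. norm (u t) \<le> C / (1 + t\<^sup>2)" using compact_support_decay[OF u R(1)] by blast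
  let ?P = "periodization T u"
  have Pc: "continuous_on A ?P" for A by (rule continuous_on_periodization[OF T u C])
  let ?v = "\<lambda>t. u t * cnj (?P t)"
  have v: "continuous_on UNIV ?v" by (intro continuous_intros u Pc)
  obtain D where D: "\<And>t. norm (?v t) \<le> D / (1 + t\<^sup>2)"
    using compact_support_decay[OF v, of R] R(1) by auto
  have "periodization T ?v t = of_real ((norm (?P t))\<^sup>2)" for t
  proof -
    have "periodization T ?v t = (\<Sum>\<^sub>\<infinity>j. u (t + of_int j * T) * cnj (?P t))"
      unfolding periodization_def[of T ?v]
      using periodic_int[where f = ?P, OF periodization_periodic[OF T u C]] by simp
    also have "\<dots> = ?P t * cnj (?P t)"
      by (subst infsum_cmult_left') (simp add: periodization_def)
    finally show ?thesis by (simp add: complex_norm_square[symmetric])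
  qed
  hence "periodization T ?v = (\<lambda>t. of_real ((norm (?P t))\<^sup>2))" by (rule ext)
  from integral_periodization[OF T v D, unfolded this]
  have "integral {0..T} (\<lambda>t. complex_of_real ((norm (?P t))\<^sup>2)) = (LINT t|lborel. ?v t)" .
  moreover have "((\<lambda>t. complex_of_real ((norm (?P t))\<^sup>2)) has_integral complex_of_real (integral {0..T} (\<lambda>t. (norm (?P t))\<^sup>2))) {0..T}"
    by (intro has_integral_of_real integrable_integral integrable_continuous_interval continuous_intros Pc)
  hence "integral {0..T} (\<lambda>t. complex_of_real ((norm (?P t))\<^sup>2)) = complex_of_real (integral {0..T} (\<lambda>t. (norm (?P t))\<^sup>2))"
    by (rule integral_unique)
  ultimately have "complex_of_real (integral {0..T} (\<lambda>t. (norm (?P t))\<^sup>2)) = (LINT t|lborel. ?v t)" by simp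
  also have "?v = (\<lambda>t. \<Sum>j\<in>{- int n..int n}. u t * cnj (u (t + of_int j * T)))"
  proof
    fix t
    show "?v t = (\<Sum>j\<in>{- int n..int n}. u t * cnj (u (t + of_int j * T)))"
    proof (cases "\<bar>t\<bar> > R")
      case False
      thus ?thesis using periodization_compact_support[OF T R, where t = t] by (simp add: sum_distrib_left)
    qed (simp add: R(1))
  qed
  also have "(LINT t|lborel. (\<Sum>j\<in>{- int n..int n}. u t * cnj (u (t + of_int j * T)))) =
    (\<Sum>j\<in>{- int n..int n}. LINT t|lborel. u t * cnj (u (t + of_int j * T)))"
  proof (rule Bochner_Integration.integral_sum)
    fix j :: int
    have c: "continuous_on UNIV (\<lambda>t. u t * cnj (u (t + of_int j * T)))"
      by (intro continuous_intros u continuous_on_compose2[OF u]) auto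
    obtain D where "\<And>t. norm (u t * cnj (u (t + of_int j * T))) \<le> D / (1 + t\<^sup>2)"
      using compact_support_decay[OF c, of R] R(1) by auto
    thus "integrable lborel (\<lambda>t. u t * cnj (u (t + of_int j * T)))"
      by (rule integrable_quadratic_decay[OF c])
  qed
  finally show ?thesis .
qed

lemma has_sum_integral_periodization:
  fixes v w :: "real \<Rightarrow> complex"
  assumes a: "a > 0" and v: "continuous_on UNIV v" "\<And>t. norm (v t) \<le> C / (1 + t\<^sup>2)"
    and w: "continuous_on UNIV w" "\<And>t. \<bar>t\<bar> > R \<Longrightarrow> w t = 0"
  shows "((\<lambda>k. LINT t|lborel. w t * v (t + of_int k * a)) has_sum (LINT t|lborel. w t * periodization a v t)) UNIV"
proof -
  have loc: "(LINT t|lborel. w t * p t) = integral {-R..R} (\<lambda>t. w t * p t)" if "continuous_on UNIV p" for p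
  proof -
    have "set_integrable lborel {-R..R} (\<lambda>t. w t * p t)"
      by (intro borel_integrable_atLeastAtMost' continuous_intros continuous_on_subset[OF w(1)] continuous_on_subset[OF that]) auto
    from set_borel_integral_eq_integral(2)[OF this]
    have "integral {-R..R} (\<lambda>t. w t * p t) = (LINT t|lborel. indicator {-R..R} t *\<^sub>R (w t * p t))"
      by (simp add: set_lebesgue_integral_def)
    also have "(\<lambda>t. indicator {-R..R} t *\<^sub>R (w t * p t)) = (\<lambda>t. w t * p t)"
      using w(2) by (force simp: indicator_def)
    finally show ?thesis by simp
  qed
  have vk: "continuous_on A (\<lambda>t. v (t + c))" for A c by (rule continuous_on_translates[OF a v])
  have pc: "continuous_on A (periodization a v)" for A by (rule continuous_on_periodization[OF a v])
  have wc: "continuous_on A w" for A by (rule continuous_on_subset[OF w(1)]) simp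
  have "bounded (w ` {-R..R})" "bounded (periodization a v ` {-R..R})"
    by (intro compact_imp_bounded compact_continuous_image compact_Icc wc pc)+
  hence "uniform_limit {-R..R} (\<lambda>X t. w t * (\<Sum>k\<in>X. v (t + of_int k * a))) (\<lambda>t. w t * periodization a v t) (finite_subsets_at_top UNIV)"
    by (intro uniform_lim_mult uniform_limit_const periodization_uniform_limit[OF a v])
  hence ul: "uniform_limit {-R..R} (\<lambda>X t. \<Sum>k\<in>X. w t * v (t + of_int k * a)) (\<lambda>t. w t * periodization a v t) (finite_subsets_at_top UNIV)"
    by (simp add: sum_distrib_left)
  have cont: "continuous_on {-R..R} (\<lambda>t. \<Sum>k\<in>X. w t * v (t + of_int k * a))" for X
    by (intro continuous_intros wc vk)
  obtain I J where IJ: "\<And>X. ((\<lambda>t. \<Sum>k\<in>X. w t * v (t + of_int k * a)) has_integral I X) {-R..R}"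
    "((\<lambda>t. w t * periodization a v t) has_integral J) {-R..R}" "(I \<longlongrightarrow> J) (finite_subsets_at_top UNIV)"
    by (rule uniform_limit_integral[OF ul cont finite_subsets_at_top_neq_bot]) blast
  have "I X = (\<Sum>k\<in>X. LINT t|lborel. w t * v (t + of_int k * a))" if "finite X" for X
    unfolding loc[OF vk] integral_unique[OF IJ(1), symmetric] using that
    by (intro integral_sum integrable_continuous_interval continuous_intros wc vk)
  hence "\<forall>\<^sub>F X in finite_subsets_at_top UNIV. I X = (\<Sum>k\<in>X. LINT t|lborel. w t * v (t + of_int k * a))"
    by (intro eventually_finite_subsets_at_top_weakI) auto
  from Lim_transform_eventually[OF IJ(3) this] show ?thesis
    unfolding has_sum_def loc[OF pc] integral_unique[OF IJ(2)] .
qed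

lemma integral_norm_correlation_le:
  fixes f :: "real \<Rightarrow> complex"
  assumes f: "continuous_on UNIV f" "\<And>t. \<bar>t\<bar> > R \<Longrightarrow> f t = 0"
  shows "integrable lborel (\<lambda>t. norm (f t * cnj (f (t + c))))"
    "(LINT t|lborel. norm (f t * cnj (f (t + c)))) \<le> (LINT t|lborel. (norm (f t))\<^sup>2)"
proof -
  have int: "integrable lborel w" if c: "continuous_on UNIV w" and z: "\<And>t. \<bar>t\<bar> > S \<Longrightarrow> w t = 0"
    for w :: "real \<Rightarrow> complex" and S
    using compact_support_decay[OF c z] integrable_quadratic_decay[OF c] by blast
  have fc: "continuous_on UNIV (\<lambda>t. f (t + c))"
    by (rule continuous_on_compose2[OF f(1)]) (auto intro!: continuous_intros)
  show i: "integrable lborel (\<lambda>t. norm (f t * cnj (f (t + c))))"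
    by (rule integrable_norm, rule int[of _ R]) (auto intro!: continuous_intros f fc)
  have "integrable lborel (\<lambda>t. f t * cnj (f t))"
    by (rule int[of _ R]) (auto intro!: continuous_intros f)
  hence sq: "integrable lborel (\<lambda>t. (norm (f t))\<^sup>2)"
    using integrable_norm by (fastforce simp: norm_mult power2_eq_square)
  have sq': "integrable lborel (\<lambda>t. (norm (f (t + c)))\<^sup>2)"
    using lborel_integrable_real_affine[OF sq, of 1 c] by (simp add: add.commute)
  have "(LINT t|lborel. norm (f t * cnj (f (t + c)))) \<le> (LINT t|lborel. ((norm (f t))\<^sup>2 + (norm (f (t + c)))\<^sup>2) / 2)"
  proof (rule integral_mono[OF i])
    show "norm (f t * cnj (f (t + c))) \<le> ((norm (f t))\<^sup>2 + (norm (f (t + c)))\<^sup>2) / 2" for t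
      using sum_squares_bound[of "norm (f t)" "norm (f (t + c))"] by (simp add: norm_mult)
  qed (use sq sq' in auto)
  also have "\<dots> = ((LINT t|lborel. (norm (f t))\<^sup>2) + (LINT t|lborel. (norm (f (t + c)))\<^sup>2)) / 2"
    using sq sq' by simp
  also have "(LINT t|lborel. (norm (f (t + c)))\<^sup>2) = (LINT t|lborel. (norm (f t))\<^sup>2)"
    using lborel_integral_real_affine[of 1 "\<lambda>t. (norm (f t))\<^sup>2" c] by (simp add: add.commute)
  finally show "(LINT t|lborel. norm (f t * cnj (f (t + c)))) \<le> (LINT t|lborel. (norm (f t))\<^sup>2)" by simp
qed

lemma has_sum_finite_sum:
  fixes f :: "'i \<Rightarrow> 'k \<Rightarrow> 'a :: topological_comm_monoid_add"
  assumes "finite J" "\<And>j. j \<in> J \<Longrightarrow> (f j has_sum s j) A"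
  shows "((\<lambda>k. \<Sum>j\<in>J. f j k) has_sum (\<Sum>j\<in>J. s j)) A"
  using assms by (induction J) (auto intro!: has_sum_add)

text \<open>
  The window \<open>g\<close> times its translate by \<open>-j T\<close>, the function of which \<open>G\<^bsub>j\<^esub>\<close> is the
  \<open>a\<close>-periodization.
\<close>

definition window_product :: "real \<Rightarrow> (real \<Rightarrow> real) \<Rightarrow> int \<Rightarrow> real \<Rightarrow> complex" where
  "window_product T g j t = of_real (g t * g (t + of_int j * T))"

text \<open>
  The inner product of \<open>f\<close> with the window \<open>g\<close> translated by \<open>k a\<close> and modulated by \<open>l / T\<close>.
  The parameters \<open>a\<close> and \<open>T\<close> are independent of each other here.
\<close>

definition gabor_coeff :: "real \<Rightarrow> real \<Rightarrow> (real \<Rightarrow> real) \<Rightarrow> (real \<Rightarrow> complex) \<Rightarrow> int \<Rightarrow> int \<Rightarrow> complex" where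
  "gabor_coeff T a g f k l = (LINT t|lborel. f t * of_real (g (t - of_int k * a)) * trig T (- l) t)"

text \<open>
  The inner products of the window with its shifts by the points of the dual lattice with
  coordinates in \<open>T \<int>\<close> and \<open>(1/a) \<int>\<close>.
\<close>

definition adjoint_coeff :: "real \<Rightarrow> real \<Rightarrow> (real \<Rightarrow> real) \<Rightarrow> int \<Rightarrow> int \<Rightarrow> complex" where
  "adjoint_coeff T a g j m = (LINT t|lborel. window_product T g j t * trig a (- m) t)"

text \<open>
  The deviation of these numbers from those of a tight frame, for which all of them vanish except
  the one at the origin.  In the application \<open>N\<close> is the squared norm of the window.
\<close>

definition adjoint_defect :: "real \<Rightarrow> real \<Rightarrow> (real \<Rightarrow> real) \<Rightarrow> real \<Rightarrow> int \<Rightarrow> int \<Rightarrow> complex" where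
  "adjoint_defect T a g N j m = adjoint_coeff T a g j m - (if j = 0 \<and> m = 0 then of_real N else 0)"

context
  fixes T a C :: real and g :: "real \<Rightarrow> real"
  assumes T: "T > 0" and a: "a > 0"
    and g: "continuous_on UNIV g" and decay: "\<And>t. \<bar>g t\<bar> \<le> C / (1 + t\<^sup>2)"
begin

lemma continuous_on_window_product: "continuous_on UNIV (window_product T g j)"
  unfolding window_product_def by (intro continuous_intros g continuous_on_compose2[OF g]) auto

lemma window_product_decay: "\<exists>D. \<forall>t. norm (window_product T g j t) \<le> D / (1 + t\<^sup>2)"
proof -
  have C0: "C \<ge> 0" using order_trans[OF abs_ge_zero decay[of 0]] by simp
  have "\<bar>g t\<bar> \<le> C" for t
    using order_trans[OF decay[of t], of C] C0 by (simp add: divide_le_eq mult_le_cancel_left1 add_pos_nonneg)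
  hence "\<bar>g t\<bar> * \<bar>g (t + of_int j * T)\<bar> \<le> C / (1 + t\<^sup>2) * C" for t
    using order_trans[OF abs_ge_zero decay[of t]] by (intro mult_mono decay) auto
  thus ?thesis by (intro exI[of _ "C * C"]) (auto simp: window_product_def norm_mult abs_mult)
qed

lemma gabor_coeff_row_has_sum:
  assumes f: "continuous_on UNIV f" "\<And>t. \<bar>t\<bar> > R \<Longrightarrow> f t = 0"
  shows "((\<lambda>l. (norm (gabor_coeff T a g f k l))\<^sup>2) has_sum
    T * integral {0..T} (\<lambda>t. (norm (periodization T (\<lambda>t. f t * of_real (g (t - of_int k * a))) t))\<^sup>2)) UNIV"
proof -
  let ?u = "\<lambda>t. f t * complex_of_real (g (t - of_int k * a))"
  have u: "continuous_on UNIV ?u"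
    by (intro continuous_intros f continuous_on_compose2[OF g]) auto
  obtain D where D: "\<And>t. norm (?u t) \<le> D / (1 + t\<^sup>2)"
    using compact_support_decay[OF u, of R] f(2) by auto
  have "((\<lambda>l. T * (norm (fourier_coeff T (periodization T ?u) l))\<^sup>2) has_sum
     integral {0..T} (\<lambda>t. (norm (periodization T ?u t))\<^sup>2)) UNIV"
    using periodization_periodic[OF T u D, of 0]
    by (intro parseval T continuous_on_periodization[OF T u D]) simp
  from has_sum_cmult_right[OF this, of T] show ?thesis
    using T unfolding fourier_coeff_periodization[OF T u D] gabor_coeff_def
    by (simp add: norm_divide power2_eq_square)
qed

text \<open>
  The expansion of the sum of all squared frame coefficients: Parseval's identity for the
  sum over \<open>l\<close>, then uniform convergence for the sum over \<open>k\<close>.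
\<close>

lemma gabor_coeff_total:
  assumes f: "continuous_on UNIV f" "\<And>t. \<bar>t\<bar> > R \<Longrightarrow> f t = 0" and n: "2 * R \<le> real n * T"
  shows "\<exists>S. ((\<lambda>(k, l). (norm (gabor_coeff T a g f k l))\<^sup>2) has_sum S) UNIV \<and>
    of_real S = T * (\<Sum>j\<in>{- int n..int n}. LINT t|lborel.
      f t * cnj (f (t + of_int j * T)) * periodization a (window_product T g j) t)"
proof -
  let ?u = "\<lambda>k t. f t * complex_of_real (g (t - of_int k * a))"
  let ?I = "\<lambda>k. integral {0..T} (\<lambda>t. (norm (periodization T (?u k) t))\<^sup>2)"
  let ?F = "\<lambda>j t. f t * cnj (f (t + of_int j * T))"
  let ?S = "\<Sum>j\<in>{- int n..int n}. LINT t|lborel. ?F j t * periodization a (window_product T g j) t"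
  have "((\<lambda>k. \<Sum>j\<in>{- int n..int n}. LINT t|lborel. ?F j t * window_product T g j (t + of_int k * a)) has_sum ?S) UNIV"
  proof (rule has_sum_finite_sum)
    fix j :: int
    obtain D where "\<And>t. norm (window_product T g j t) \<le> D / (1 + t\<^sup>2)"
      using window_product_decay by blast
    thus "((\<lambda>k. LINT t|lborel. ?F j t * window_product T g j (t + of_int k * a)) has_sum
        (LINT t|lborel. ?F j t * periodization a (window_product T g j) t)) UNIV"
      by (rule has_sum_integral_periodization[OF a continuous_on_window_product, where R = R])
         (auto intro!: continuous_intros f continuous_on_compose2[OF f(1)] simp: f(2))
  qed simp
  moreover have "(\<Sum>j\<in>{- int n..int n}. LINT t|lborel. ?F j t * window_product T g j (t + of_int k * a)) = of_real (?I (- k))" for k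
  proof -
    have u: "continuous_on UNIV (?u (- k))"
      by (intro continuous_intros f continuous_on_compose2[OF g]) auto
    have "of_real (?I (- k)) = (\<Sum>j\<in>{- int n..int n}. LINT t|lborel. ?u (- k) t * cnj (?u (- k) (t + of_int j * T)))"
      by (rule integral_norm_periodization_sq[OF T u _ n]) (simp add: f(2))
    also have "\<dots> = (\<Sum>j\<in>{- int n..int n}. LINT t|lborel. ?F j t * window_product T g j (t + of_int k * a))"
      by (intro sum.cong refl Bochner_Integration.integral_cong) (simp add: window_product_def algebra_simps)
    finally show ?thesis by simp
  qed
  ultimately have "((\<lambda>k. complex_of_real (?I (- k))) has_sum ?S) UNIV" by simp
  hence "((\<lambda>k. complex_of_real (?I k)) has_sum ?S) UNIV"
    by (subst (asm) has_sum_reindex_bij_betw[of uminus UNIV UNIV "\<lambda>k. complex_of_real (?I k)"])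
       (auto intro: bij_uminus)
  hence hs: "((\<lambda>k. of_real T * complex_of_real (?I k)) has_sum of_real T * ?S) UNIV"
    by (rule has_sum_cmult_right)
  from has_sum_Re[OF this] have hr: "((\<lambda>k. T * ?I k) has_sum Re (of_real T * ?S)) UNIV" by simp
  from has_sum_of_real[OF this, where 'a = complex] hs
  have re: "of_real (Re (of_real T * ?S)) = of_real T * ?S"
    by (intro has_sum_unique) auto
  have "(\<lambda>(k, l). (norm (gabor_coeff T a g f k l))\<^sup>2) summable_on (UNIV \<times> UNIV)"
    by (rule summable_on_SigmaI[where g = "\<lambda>k. T * ?I k"])
       (use gabor_coeff_row_has_sum[OF f] hr in \<open>auto simp: summable_on_def\<close>)
  hence "((\<lambda>(k, l). (norm (gabor_coeff T a g f k l))\<^sup>2) has_sum Re (of_real T * ?S)) (UNIV \<times> UNIV)"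
    by (intro has_sum_SigmaI[OF _ hr]) (use gabor_coeff_row_has_sum[OF f] in auto)
  thus ?thesis using re by (intro exI[of _ "Re (of_real T * ?S)"]) simp
qed

lemma correlation_near_constant:
  assumes "(\<lambda>m. norm (adjoint_defect T a g N j m)) summable_on UNIV"
  shows "norm (periodization a (window_product T g j) t - (if j = 0 then of_real (N / a) else 0))
    \<le> (\<Sum>\<^sub>\<infinity>m. norm (adjoint_defect T a g N j m)) / a"
proof -
  obtain D where D: "\<And>t. norm (window_product T g j t) \<le> D / (1 + t\<^sup>2)"
    using window_product_decay by blast
  note w = continuous_on_window_product[of j] D
  let ?P = "periodization a (window_product T g j)"
  have c: "fourier_coeff a ?P m = adjoint_coeff T a g j m / a" for m
    unfolding adjoint_coeff_def by (rule fourier_coeff_periodization[OF a w])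
  have "(\<lambda>m. norm (adjoint_defect T a g N j m)) summable_on (UNIV - {0})"
    by (rule summable_on_subset_banach[OF assms]) simp
  also have "?this \<longleftrightarrow> (\<lambda>m. norm (adjoint_coeff T a g j m)) summable_on (UNIV - {0})"
    by (intro summable_on_cong) (simp add: adjoint_defect_def)
  finally have "(\<lambda>m. norm (adjoint_coeff T a g j m)) summable_on insert 0 (UNIV - {0})"
    by (subst summable_on_insert_iff)
  hence "(\<lambda>m. norm (adjoint_coeff T a g j m)) summable_on UNIV" by simp
  from summable_on_cmult_right[OF this, of "1 / a"]
  have "(\<lambda>m. norm (fourier_coeff a ?P m)) summable_on UNIV"
    using a unfolding c by (simp add: norm_divide)
  hence hs: "((\<lambda>m. fourier_coeff a ?P m * trig a m t) has_sum ?P t) UNIV"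
    by (intro fourier_series_has_sum a continuous_on_periodization[OF a w] periodization_periodic[OF a w])
  have "((\<lambda>m. - (if j = 0 \<and> m = 0 then of_real (N / a) else 0) * trig a m t) has_sum - (if j = 0 then of_real (N / a) else 0)) UNIV"
    by (rule has_sum_finite_neutralI[of "{0}"]) auto
  from has_sum_add[OF hs this]
  have "((\<lambda>m. fourier_coeff a ?P m * trig a m t + - (if j = 0 \<and> m = 0 then of_real (N / a) else 0) * trig a m t)
    has_sum (?P t - (if j = 0 then of_real (N / a) else 0))) UNIV"
    by (simp only: add_uminus_conv_diff)
  also have "?this \<longleftrightarrow> ((\<lambda>m. adjoint_defect T a g N j m / a * trig a m t)
    has_sum (?P t - (if j = 0 then of_real (N / a) else 0))) UNIV"
    by (intro has_sum_cong) (simp add: c adjoint_defect_def diff_divide_distrib left_diff_distrib)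
  finally have "((\<lambda>m. adjoint_defect T a g N j m / a * trig a m t)
    has_sum (?P t - (if j = 0 then of_real (N / a) else 0))) UNIV" .
  moreover have "((\<lambda>m. norm (adjoint_defect T a g N j m) / a) has_sum (\<Sum>\<^sub>\<infinity>m. norm (adjoint_defect T a g N j m)) / a) UNIV"
    using has_sum_cmult_right[OF has_sum_infsum[OF assms], of "1 / a"] by simp
  ultimately show ?thesis
    by (rule norm_infsum_le) (use a in \<open>simp add: norm_mult norm_divide\<close>)
qed

text \<open>
  The term at the origin of the dual lattice equals \<open>T/a\<close> times \<open>N E\<close>; each of the others is
  estimated by its absolute value, using that the autocorrelation of \<open>\<bar>f\<bar>\<close> is at most \<open>E\<close>.
\<close>

theorem gabor_coeff_estimate:
  assumes f: "continuous_on UNIV f" "\<And>t. \<bar>t\<bar> > R \<Longrightarrow> f t = 0"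
    and summable: "(\<lambda>(j, m). norm (adjoint_defect T a g N j m)) summable_on UNIV"
    and s: "(\<Sum>\<^sub>\<infinity>(j, m). norm (adjoint_defect T a g N j m)) \<le> s"
  defines "E \<equiv> (LINT t|lborel. (norm (f t))\<^sup>2)"
  shows "\<exists>S. ((\<lambda>(k, l). (norm (gabor_coeff T a g f k l))\<^sup>2) has_sum S) UNIV \<and> \<bar>S - T / a * N * E\<bar> \<le> T / a * s * E"
proof -
  obtain n :: nat where "2 * R / T \<le> real n" using real_arch_simple by blast
  hence n: "2 * R \<le> real n * T" using T by (simp add: pos_divide_le_eq)
  define J where "J = {- int n..int n}"
  let ?F = "\<lambda>j t. f t * cnj (f (t + of_int j * T))"
  let ?P = "\<lambda>j. periodization a (window_product T g j)"
  let ?k = "\<lambda>j. if j = 0 then complex_of_real (N / a) else 0"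
  let ?b = "\<lambda>j. \<Sum>\<^sub>\<infinity>m. norm (adjoint_defect T a g N j m)"
  obtain S where S: "((\<lambda>(k, l). (norm (gabor_coeff T a g f k l))\<^sup>2) has_sum S) UNIV"
    "of_real S = T * (\<Sum>j\<in>J. LINT t|lborel. ?F j t * ?P j t)"
    using gabor_coeff_total[OF f n] unfolding J_def by blast
  have row: "(\<lambda>m. norm (adjoint_defect T a g N j m)) summable_on UNIV" for j
    using summable_on_SigmaD1[of "\<lambda>j m. norm (adjoint_defect T a g N j m)" UNIV "\<lambda>_. UNIV" j] summable by simp
  have E0: "E \<ge> 0" unfolding E_def by (rule integral_nonneg_AE) simp
  have Fc: "continuous_on UNIV (?F j)" for j
    by (auto intro!: continuous_intros f continuous_on_compose2[OF f(1)])
  have Pc: "continuous_on UNIV (?P j)" for j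
    using window_product_decay[of j] continuous_on_periodization[OF a continuous_on_window_product] by blast
  have int: "integrable lborel (\<lambda>t. ?F j t * p t)" if p: "continuous_on UNIV p" for j and p :: "real \<Rightarrow> complex"
  proof -
    have c: "continuous_on UNIV (\<lambda>t. ?F j t * p t)" by (intro continuous_on_mult Fc p)
    obtain D where "\<And>t. norm (?F j t * p t) \<le> D / (1 + t\<^sup>2)"
      using compact_support_decay[OF c, of R] f(2) by auto
    thus ?thesis by (rule integrable_quadratic_decay[OF c])
  qed
  have main: "(LINT t|lborel. ?F j t * ?k j) = (if j = 0 then of_real (N / a * E) else 0)" for j
  proof (cases "j = 0")
    case True
    have "(LINT t|lborel. ?F j t * ?k j) = (LINT t|lborel. complex_of_real (N / a * (norm (f t))\<^sup>2))"
      using True by (intro Bochner_Integration.integral_cong refl) (simp add: complex_norm_square[symmetric] mult.commute flip: of_real_power)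
    also have "\<dots> = of_real (LINT t|lborel. N / a * (norm (f t))\<^sup>2)" by (rule integral_complex_of_real)
    also have "(LINT t|lborel. N / a * (norm (f t))\<^sup>2) = N / a * E" unfolding E_def by simp
    finally show ?thesis using True by simp
  qed simp
  have diff: "norm (LINT t|lborel. ?F j t * (?P j t - ?k j)) \<le> ?b j / a * E" for j
  proof -
    have b: "norm (?P j t - ?k j) \<le> ?b j / a" for t by (rule correlation_near_constant[OF row])
    have b0: "?b j / a \<ge> 0" using order_trans[OF norm_ge_zero b[of 0]] .
    have "norm (LINT t|lborel. ?F j t * (?P j t - ?k j)) \<le> (LINT t|lborel. norm (?F j t * (?P j t - ?k j)))"
      by (rule integral_norm_bound)
    also have "\<dots> \<le> (LINT t|lborel. ?b j / a * norm (?F j t))"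
    proof (rule integral_mono)
      show "integrable lborel (\<lambda>t. norm (?F j t * (?P j t - ?k j)))"
        by (intro integrable_norm int continuous_intros Pc)
      show "integrable lborel (\<lambda>t. ?b j / a * norm (?F j t))"
        by (intro integrable_mult_right integral_norm_correlation_le(1)[OF f])
      show "norm (?F j t * (?P j t - ?k j)) \<le> ?b j / a * norm (?F j t)" for t
        unfolding norm_mult[of "?F j t"] using b[of t] by (simp only: mult.commute mult_left_mono norm_ge_zero)
    qed
    also have "\<dots> = ?b j / a * (LINT t|lborel. norm (?F j t))" by simp
    also have "\<dots> \<le> ?b j / a * E"
      unfolding E_def by (intro mult_left_mono integral_norm_correlation_le(2)[OF f] b0)
    finally show ?thesis .
  qed
  have total: "complex_of_real (S - T / a * N * E) = T * (\<Sum>j\<in>J. LINT t|lborel. ?F j t * (?P j t - ?k j))"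
  proof -
    have "(\<Sum>j\<in>J. LINT t|lborel. ?F j t * (?P j t - ?k j)) = (\<Sum>j\<in>J. (LINT t|lborel. ?F j t * ?P j t) - (LINT t|lborel. ?F j t * ?k j))"
      unfolding right_diff_distrib by (intro sum.cong refl Bochner_Integration.integral_diff int Pc continuous_on_const)
    also have "\<dots> = (\<Sum>j\<in>J. LINT t|lborel. ?F j t * ?P j t) - of_real (N / a * E)"
      unfolding main sum_subtractf by (simp add: J_def)
    finally have eq: "(\<Sum>j\<in>J. LINT t|lborel. ?F j t * (?P j t - ?k j)) =
      (\<Sum>j\<in>J. LINT t|lborel. ?F j t * ?P j t) - of_real (N / a * E)" .
    have "complex_of_real (S - T / a * N * E) = of_real S - of_real T * of_real (N / a * E)" by simp
    also have "\<dots> = T * (\<Sum>j\<in>J. LINT t|lborel. ?F j t * (?P j t - ?k j))"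
      unfolding eq S(2) by (rule right_diff_distrib[symmetric])
    finally show ?thesis .
  qed
  have "\<bar>S - T / a * N * E\<bar> = norm (complex_of_real (S - T / a * N * E))"
    by (rule norm_of_real[symmetric])
  also have "\<dots> = T * norm (\<Sum>j\<in>J. LINT t|lborel. ?F j t * (?P j t - ?k j))"
    unfolding total norm_mult norm_of_real abs_of_pos[OF T] ..
  also have "\<dots> \<le> T * (\<Sum>j\<in>J. ?b j / a * E)"
    using T by (intro mult_left_mono order_trans[OF norm_sum] sum_mono diff) auto
  also have "\<dots> = T / a * (\<Sum>j\<in>J. ?b j) * E"
    by (simp add: sum_distrib_left sum_distrib_right mult.assoc)
  also have "\<dots> \<le> T / a * s * E"
  proof (intro mult_right_mono mult_left_mono E0)
    have sub: "(\<lambda>(j, m). norm (adjoint_defect T a g N j m)) summable_on (J \<times> UNIV)"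
      by (rule summable_on_subset_banach[OF summable]) auto
    have "(\<Sum>j\<in>J. ?b j) = (\<Sum>\<^sub>\<infinity>j\<in>J. ?b j)" by (simp add: J_def)
    also have "\<dots> = (\<Sum>\<^sub>\<infinity>(j, m)\<in>J \<times> UNIV. norm (adjoint_defect T a g N j m))"
      by (rule infsum_Sigma'_banach[OF sub])
    also have "\<dots> \<le> (\<Sum>\<^sub>\<infinity>(j, m). norm (adjoint_defect T a g N j m))"
      by (rule infsum_mono2[OF sub summable]) auto
    also have "\<dots> \<le> s" by (rule s)
    finally show "(\<Sum>j\<in>J. ?b j) \<le> s" .
  qed (use T a in auto)
  finally show ?thesis using S(1) by blast
qed

end

section \<open>Summing the ambiguity function over the dual lattice\<close>

text \<open>
  The modulus of the ambiguity function of the Hermite function of order 15 at the points of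
  the dual lattice, set to 0 at the origin.
\<close>

definition lattice_weight :: "real \<Rightarrow> int \<times> int \<Rightarrow> real" where
  "lattice_weight \<delta> = (\<lambda>(j, m). if j = 0 \<and> m = 0 then 0 else
     \<bar>laguerre 15 (pi * (\<delta> * ((of_int j)\<^sup>2 + (of_int m)\<^sup>2)))\<bar> * exp (- (pi * (\<delta> * ((of_int j)\<^sup>2 + (of_int m)\<^sup>2))) / 2))"

lemma abs_le_square_int: "\<bar>j\<bar> \<le> j\<^sup>2" for j :: int
  using self_le_power[of "\<bar>j\<bar>" 2] by (cases "j = 0") auto

text \<open>
  For points other than the origin and its eight neighbours.  Since \<open>11 \<pi> \<ge> 34.5\<close>, the crude
  bound decays like \<open>exp (-8.625 r)\<close> with \<open>r = j\<^sup>2 + m\<^sup>2\<close>.  Of this exponent, 31 is spent on the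
  factor \<open>5\<^sup>1\<^sup>5\<close>, and the rest dominates \<open>3/4\<close> times \<open>\<bar>j\<bar> + \<bar>m\<bar>\<close> as \<open>r \<ge> 4\<close>.
\<close>

lemma lattice_weight_far:
  assumes "\<delta> \<ge> 11" "j\<^sup>2 + m\<^sup>2 \<ge> 4"
  shows "lattice_weight \<delta> (j, m) \<le> (1/2) ^ nat \<bar>j\<bar> * (1/2) ^ nat \<bar>m\<bar> / 500"
proof -
  define r where "r = (of_int j)\<^sup>2 + (of_int m :: real)\<^sup>2"
  have r: "r = of_int (j\<^sup>2 + m\<^sup>2)" by (simp add: r_def)
  have r4: "r \<ge> 4" using assms(2) unfolding r by linarith
  have "\<bar>j\<bar> + \<bar>m\<bar> \<le> j\<^sup>2 + m\<^sup>2" using abs_le_square_int[of j] abs_le_square_int[of m] by linarith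
  hence rn: "real (nat \<bar>j\<bar> + nat \<bar>m\<bar>) \<le> r" unfolding r by linarith
  have pi: "pi * 11 \<ge> 34.5" using pi_approx by simp
  have "34.5 * r \<le> pi * 11 * r" using pi r4 by (intro mult_right_mono) auto
  also have "\<dots> \<le> pi * \<delta> * r" using assms(1) r4 by (intro mult_right_mono mult_left_mono) auto
  finally have x: "34.5 * r \<le> pi * (\<delta> * r)" by (simp only: mult.assoc)
  have "lattice_weight \<delta> (j, m) \<le> \<bar>laguerre 15 (pi * (\<delta> * r))\<bar> * exp (- (pi * (\<delta> * r)) / 2)"
    by (simp add: lattice_weight_def r_def)
  also have "\<dots> \<le> 5 ^ 15 * exp (- (pi * (\<delta> * r)) / 4)"
    using laguerre_bound[of "pi * (\<delta> * r)" 15] x r4 by simp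
  also have "\<dots> \<le> 5 ^ 15 * exp (- 31 + - real (nat \<bar>j\<bar> + nat \<bar>m\<bar>) * (3/4))"
  proof -
    have "- P / 4 \<le> - 31 + - N * (3/4)" if "34.5 * r \<le> P" "4 \<le> r" "N \<le> r" for P N :: real
      using that by linarith
    from this[OF x r4 rn] show ?thesis by (intro mult_left_mono) simp_all
  qed
  also have "\<dots> = 5 ^ 15 / exp 31 * exp (- (3/4)) ^ (nat \<bar>j\<bar> + nat \<bar>m\<bar>)"
  proof -
    have "exp (- 31 + - real N * (3/4)) = inverse (exp 31) * exp (- (3/4)) ^ N" for N
      unfolding exp_add exp_of_nat_mult[symmetric] exp_minus[of 31] by simp
    thus ?thesis by (simp only: divide_inverse mult.assoc)
  qed
  also have "\<dots> \<le> 1 / 500 * (1/2) ^ (nat \<bar>j\<bar> + nat \<bar>m\<bar>)"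
  proof (intro mult_mono power_mono)
    have "(5::real) ^ 15 * 500 \<le> 2.716 ^ 31" by (simp add: power_divide)
    also have "\<dots> \<le> exp (real 31)" by (rule exp_nat_ge)
    finally show "5 ^ 15 / exp (31::real) \<le> 1 / 500" by (simp add: field_simps)
    have "2 \<le> 1 + 3/4 + (3/4)\<^sup>2 / (2::real)" by (simp add: power2_eq_square)
    also have "\<dots> \<le> exp (3/4)" by (rule exp_lower_Taylor_quadratic) simp
    finally show "exp (- (3/4)) \<le> (1/2::real)" by (simp add: exp_minus field_simps)
  qed auto
  finally show ?thesis by (simp add: power_add)
qed

lemma lattice_weight_near:
  assumes "\<delta> \<ge> 11"
  shows "j\<^sup>2 + m\<^sup>2 = 1 \<Longrightarrow> lattice_weight \<delta> (j, m) \<le> 19/100"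
    and "j\<^sup>2 + m\<^sup>2 = 2 \<Longrightarrow> lattice_weight \<delta> (j, m) \<le> 4/100"
proof -
  have pi: "pi * 11 \<ge> 34.5" using pi_approx by simp
  have "pi * 11 \<le> pi * \<delta>" using assms by simp
  hence d: "34.5 \<le> pi * \<delta>" using pi by linarith
  have r: "(of_int j)\<^sup>2 + (of_int m)\<^sup>2 = real_of_int (j\<^sup>2 + m\<^sup>2)" by simp
  { assume "j\<^sup>2 + m\<^sup>2 = 1"
    thus "lattice_weight \<delta> (j, m) \<le> 19/100"
      using laguerre15_bound_31[of "pi * \<delta>"] d unfolding lattice_weight_def prod.case r by simp }
  { assume "j\<^sup>2 + m\<^sup>2 = 2"
    thus "lattice_weight \<delta> (j, m) \<le> 4/100"
      using laguerre15_bound_69[of "pi * (\<delta> * 2)"] d unfolding lattice_weight_def prod.case r by simp }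
qed

lemma sum_geometric_int: "(\<Sum>j\<in>{- int n..int n}. (1/2) ^ nat \<bar>j\<bar> :: real) = 3 - 2 * (1/2) ^ n"
proof (induction n)
  case (Suc n)
  have "{- int (Suc n)..int (Suc n)} = insert (- int (Suc n)) (insert (int (Suc n)) {- int n..int n})" by auto
  thus ?case using Suc by (simp add: nat_add_distrib)
qed simp

lemma int_pair_norm_cases:
  fixes j m :: int
  shows "j\<^sup>2 + m\<^sup>2 = 1 \<Longrightarrow> (j, m) \<in> {(1, 0), (-1, 0), (0, 1), (0, -1)}"
    and "j\<^sup>2 + m\<^sup>2 = 2 \<Longrightarrow> (j, m) \<in> {(1, 1), (-1, 1), (1, -1), (-1, -1)}"
    and "\<not> j\<^sup>2 + m\<^sup>2 = 3"
proof -
  have b: "j \<in> {-1, 0, 1} \<and> m \<in> {-1, 0, 1}" if "j\<^sup>2 + m\<^sup>2 < 4"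
  proof -
    have "j\<^sup>2 < 4" "m\<^sup>2 < 4" using that zero_le_power2[of j] zero_le_power2[of m] by linarith+
    hence "\<bar>j\<bar> < 2" "\<bar>m\<bar> < 2"
      by (auto intro: power2_less_imp_less[of "\<bar>j\<bar>" 2] power2_less_imp_less[of "\<bar>m\<bar>" 2])
    thus ?thesis by auto
  qed
  show "j\<^sup>2 + m\<^sup>2 = 1 \<Longrightarrow> (j, m) \<in> {(1, 0), (-1, 0), (0, 1), (0, -1)}"
    "j\<^sup>2 + m\<^sup>2 = 2 \<Longrightarrow> (j, m) \<in> {(1, 1), (-1, 1), (1, -1), (-1, -1)}"
    "\<not> j\<^sup>2 + m\<^sup>2 = 3"
    using b by auto
qed

text \<open>
  The three groups of points contribute at most \<open>4 * 0.19\<close>, \<open>4 * 0.04\<close> and \<open>9 / 500\<close>.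
\<close>

lemma sum_lattice_weight_le:
  assumes \<delta>: "\<delta> \<ge> 11" and F: "finite F"
  shows "sum (lattice_weight \<delta>) F \<le> 95/100"
proof -
  define Q1 :: "(int \<times> int) set" where "Q1 = {(1, 0), (-1, 0), (0, 1), (0, -1)}"
  define Q2 :: "(int \<times> int) set" where "Q2 = {(1, 1), (-1, 1), (1, -1), (-1, -1)}"
  define G :: "int \<times> int \<Rightarrow> real" where "G = (\<lambda>(j, m). (1/2) ^ nat \<bar>j\<bar> * (1/2) ^ nat \<bar>m\<bar>)"
  have G0: "G p \<ge> 0" for p by (simp add: G_def split: prod.splits)
  have le: "lattice_weight \<delta> p \<le> (if p \<in> Q1 then 19/100 else 0) + (if p \<in> Q2 then 4/100 else 0) + G p / 500" for p
  proof -
    obtain j m where p: "p = (j, m)" by (cases p)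
    have ge: "j\<^sup>2 + m\<^sup>2 \<ge> 0" by simp
    consider "j\<^sup>2 + m\<^sup>2 = 0" | "j\<^sup>2 + m\<^sup>2 = 1" | "j\<^sup>2 + m\<^sup>2 = 2" | "j\<^sup>2 + m\<^sup>2 \<ge> 4"
      using ge int_pair_norm_cases(3)[of j m] by linarith
    thus ?thesis
    proof cases
      case 1
      hence "lattice_weight \<delta> p = 0" by (simp add: p lattice_weight_def sum_power2_eq_zero_iff)
      thus ?thesis using G0[of p] by auto
    next
      case 2
      hence "p \<in> Q1" unfolding p Q1_def by (rule int_pair_norm_cases)
      thus ?thesis using lattice_weight_near(1)[OF \<delta> 2] G0[of p] by (auto simp: p)
    next
      case 3
      hence "p \<in> Q2" unfolding p Q2_def by (rule int_pair_norm_cases)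
      thus ?thesis using lattice_weight_near(2)[OF \<delta> 3] G0[of p] by (auto simp: p)
    next
      case 4
      have "lattice_weight \<delta> p \<le> G p / 500"
        using lattice_weight_far[OF \<delta> 4] by (simp add: p G_def)
      thus ?thesis by auto
    qed
  qed
  have fin: "(\<Sum>p\<in>F. if p \<in> Q then c else 0) \<le> 4 * c" if "finite Q" "card Q \<le> 4" "c \<ge> 0" for Q and c :: real
  proof -
    have "(\<Sum>p\<in>F. if p \<in> Q then c else 0) = of_nat (card (F \<inter> Q)) * c"
      using F by (simp add: sum.inter_restrict[symmetric])
    moreover have "card (F \<inter> Q) \<le> 4"
      using card_mono[OF that(1), of "F \<inter> Q"] that(2) by simp
    ultimately show ?thesis using that(3) by (simp add: mult_right_mono)
  qed
  have GF: "sum G F \<le> 9"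
  proof -
    have "finite (\<Union>(j, m)\<in>F. {nat \<bar>j\<bar>, nat \<bar>m\<bar>})" using F by auto
    then obtain n where n: "\<And>j m. (j, m) \<in> F \<Longrightarrow> nat \<bar>j\<bar> \<le> n \<and> nat \<bar>m\<bar> \<le> n"
      unfolding finite_nat_set_iff_bounded_le by blast
    let ?A = "{- int n..int n}"
    have "F \<subseteq> ?A \<times> ?A" using n by force
    hence "sum G F \<le> sum G (?A \<times> ?A)" using G0 by (intro sum_mono2) auto
    also have "\<dots> = (\<Sum>j\<in>?A. (1/2) ^ nat \<bar>j\<bar>) * (\<Sum>m\<in>?A. (1/2) ^ nat \<bar>m\<bar>)"
      unfolding sum_product sum.cartesian_product G_def ..
    also have "\<dots> \<le> 3 * 3"
    proof -
      have "(1/2) ^ n \<le> (1::real)" by (simp add: power_le_one)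
      thus ?thesis unfolding sum_geometric_int by (intro mult_mono) simp_all
    qed
    finally show ?thesis by simp
  qed
  have "sum (lattice_weight \<delta>) F \<le> (\<Sum>p\<in>F. (if p \<in> Q1 then 19/100 else 0) + (if p \<in> Q2 then 4/100 else 0) + G p / 500)"
    by (intro sum_mono le)
  also have "\<dots> = (\<Sum>p\<in>F. if p \<in> Q1 then 19/100 else 0) + (\<Sum>p\<in>F. if p \<in> Q2 then 4/100 else 0) + sum G F / 500"
    by (simp add: sum.distrib sum_divide_distrib)
  also have "\<dots> \<le> 4 * (19/100) + 4 * (4/100) + 9 / 500"
    by (intro add_mono fin divide_right_mono GF) (auto simp: Q1_def Q2_def)
  also have "\<dots> \<le> 95/100" by simp
  finally show ?thesis .
qed

lemma lattice_weight_summable: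
  assumes \<delta>: "\<delta> \<ge> 11"
  shows "lattice_weight \<delta> summable_on UNIV" "infsum (lattice_weight \<delta>) UNIV \<le> 95/100"
proof -
  show s: "lattice_weight \<delta> summable_on UNIV"
    by (rule nonneg_bdd_above_summable_on)
       (auto simp: bdd_above_def lattice_weight_def split: prod.splits if_splits
             intro!: exI[of _ "95/100"] sum_lattice_weight_le[OF \<delta>, unfolded lattice_weight_def])
  show "infsum (lattice_weight \<delta>) UNIV \<le> 95/100"
    by (rule infsum_le_finite_sums[OF s sum_lattice_weight_le[OF \<delta>]])
qed

section \<open>The Gabor system of the Hermite function of order 15\<close>

lemma laguerre_at_0: "laguerre n 0 = 1"
proof -
  have "laguerre n 0 = (\<Sum>j\<in>{0}. of_nat (n choose j) / fact j * (- 0) ^ j)"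
    unfolding laguerre_def by (rule sum.mono_neutral_right) auto
  thus ?thesis by simp
qed

lemma continuous_hermite_fun: "continuous_on A (hermite_fun n)"
  unfolding hermite_fun_eq[abs_def] by (intro continuous_intros)

lemma hermite_fun_decay: "\<exists>C. \<forall>t. \<bar>hermite_fun n t\<bar> \<le> C / (1 + t\<^sup>2)"
proof -
  obtain C where C: "\<And>t. \<bar>herm_gauss n t\<bar> \<le> C / (1 + t\<^sup>2)" using herm_gauss_decay by blast
  have "\<bar>hermite_fun n t\<bar> \<le> (\<bar>hermite_const n\<bar> * C) / (1 + t\<^sup>2)" for t
    using mult_left_mono[OF C[of t], of "\<bar>hermite_const n\<bar>"] by (simp add: hermite_fun_eq abs_mult)
  thus ?thesis by blast
qed

lemma hermite_adjoint_coeff: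
  assumes "\<delta> > 0"
  shows "adjoint_coeff (sqrt \<delta>) (1 / sqrt \<delta>) (hermite_fun n) j m =
    of_real ((hermite_const n)\<^sup>2) * ambiguity n n (of_int j * sqrt \<delta>) (of_int m * sqrt \<delta>)"
proof -
  have "window_product (sqrt \<delta>) (hermite_fun n) j t * trig (1 / sqrt \<delta>) (- m) t =
     of_real ((hermite_const n)\<^sup>2) * (of_real (herm_gauss n t * herm_gauss n (t + of_int j * sqrt \<delta>)) * cis (- 2 * pi * (of_int m * sqrt \<delta>) * t))" for t
    by (simp add: window_product_def trig_def hermite_fun_eq power2_eq_square mult_ac)
  thus ?thesis unfolding adjoint_coeff_def ambiguity_def by (simp only: integral_mult_right_zero)
qed

lemma norm_hermite_adjoint_defect:
  assumes "\<delta> > 0"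
  shows "norm (adjoint_defect (sqrt \<delta>) (1 / sqrt \<delta>) (hermite_fun 15) 1 j m) = lattice_weight \<delta> (j, m)"
proof (cases "j = 0 \<and> m = 0")
  case True
  have "ambiguity 15 15 0 0 = of_real (1 / sqrt 2 * (fact 15 * (4 * pi) ^ 15))"
    unfolding ambiguity_diagonal[of 15] ambiguity_0_0 by (simp add: laguerre_at_0)
  hence "of_real ((hermite_const 15)\<^sup>2) * ambiguity 15 15 0 0 = 1"
    unfolding hermite_const_sq of_real_mult[symmetric] by simp
  thus ?thesis using True assms by (simp add: adjoint_defect_def hermite_adjoint_coeff lattice_weight_def)
next
  case False
  have r: "(of_int j * sqrt \<delta>)\<^sup>2 + (of_int m * sqrt \<delta>)\<^sup>2 = \<delta> * ((of_int j)\<^sup>2 + (of_int m)\<^sup>2)"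
    using assms by (simp add: power_mult_distrib algebra_simps)
  have "norm (adjoint_coeff (sqrt \<delta>) (1 / sqrt \<delta>) (hermite_fun 15) j m) = lattice_weight \<delta> (j, m)"
    using False unfolding hermite_adjoint_coeff[OF assms] norm_hermite_ambiguity r
    by (auto simp: lattice_weight_def)
  thus ?thesis using False by (auto simp: adjoint_defect_def)
qed

lemma tf_shift_L2:
  fixes g :: "real \<Rightarrow> real"
  assumes g: "continuous_on UNIV g" "\<And>t. \<bar>g t\<bar> \<le> C / (1 + t\<^sup>2)"
  shows "tf_shift (x, w) (\<lambda>t. of_real (g t)) \<in> L2"
proof -
  let ?\<phi> = "tf_shift (x, w) (\<lambda>t. complex_of_real (g t))"
  have c: "continuous_on UNIV ?\<phi>"
    unfolding tf_shift_def prod.case by (intro continuous_intros continuous_on_compose2[OF g(1)]) auto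
  have m: "?\<phi> \<in> borel_measurable borel" by (rule borel_measurable_continuous_onI[OF c])
  obtain D where D: "\<And>t. norm (window_product 1 g 0 t) \<le> D / (1 + t\<^sup>2)"
    using window_product_decay[OF zero_less_one zero_less_one g, of 0] by blast
  have "integrable lborel (window_product 1 g 0)"
    by (rule integrable_quadratic_decay[OF continuous_on_window_product[OF zero_less_one zero_less_one g] D])
  from integrable_norm[OF this] have "integrable lborel (\<lambda>t. (g t)\<^sup>2)"
    by (simp add: window_product_def norm_mult power2_eq_square)
  from lborel_integrable_real_affine[OF this, of 1 "- x"] have "integrable lborel (\<lambda>t. (g (t - x))\<^sup>2)"
    by simp
  hence "integrable lborel (\<lambda>t. (norm (?\<phi> t))\<^sup>2)"
    by (simp add: tf_shift_def norm_mult)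
  hence "integrable lebesgue (\<lambda>t. (norm (?\<phi> t))\<^sup>2)"
    using m by (subst integrable_completion) measurable
  thus ?thesis using m by (simp add: L2_def measurable_completion)
qed

lemma L2_inner_tf_shift:
  fixes g :: "real \<Rightarrow> real"
  assumes f: "continuous_on UNIV f" and g: "continuous_on UNIV g" and T: "T > 0"
  shows "L2_inner f (tf_shift (a * of_int k, 1 / T * of_int l) (\<lambda>t. of_real (g t))) = gabor_coeff T a g f k l"
proof -
  have "f t * cnj (tf_shift (a * of_int k, 1 / T * of_int l) (\<lambda>t. of_real (g t)) t)
     = f t * of_real (g (t - of_int k * a)) * trig T (- l) t" (is "?l t = ?r t") for t
  proof -
    have "exp (2 * of_real pi * \<i> * of_real (1 / T * of_int l) * of_real t) = trig T l t"
      by (simp add: trig_def cis_conv_exp mult_ac)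
    thus ?thesis by (simp add: tf_shift_def cnj_trig mult_ac)
  qed
  hence eq: "?l = ?r" by (rule ext)
  have "L2_inner f (tf_shift (a * of_int k, 1 / T * of_int l) (\<lambda>t. of_real (g t))) =
    (LINT t|lebesgue. f t * of_real (g (t - of_int k * a)) * trig T (- l) t)"
    unfolding L2_inner_def eq ..
  also have "\<dots> = gabor_coeff T a g f k l"
    unfolding gabor_coeff_def
  proof (rule integral_completion)
    have "continuous_on UNIV (\<lambda>t. f t * of_real (g (t - of_int k * a)) * trig T (- l) t)"
      by (intro continuous_intros f continuous_on_compose2[OF g]) auto
    thus "(\<lambda>t. f t * of_real (g (t - of_int k * a)) * trig T (- l) t) \<in> borel_measurable lborel"
      using borel_measurable_continuous_onI by simp
  qed
  finally show ?thesis .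
qed

theorem proposition3p5:
  fixes \<delta> :: real
  assumes "\<delta> \<ge> 11"
  shows "gabor_frame (\<lambda>t. complex_of_real (hermite_fun 15 t)) (scaled_int_lattice (1 / sqrt \<delta>))"
proof -
  define T where "T = sqrt \<delta>"
  define a where "a = 1 / sqrt \<delta>"
  let ?h = "hermite_fun 15"
  let ?\<phi> = "gabor_system (\<lambda>t. complex_of_real (?h t))"
  let ?e = "\<lambda>(k, l). (a * real_of_int k, a * real_of_int l)"
  have \<delta>: "\<delta> > 0" using assms by simp
  have T: "T > 0" "a > 0" "a = 1 / T" "T / a = \<delta>" using \<delta> by (auto simp: T_def a_def)
  obtain C where C: "\<And>t. \<bar>?h t\<bar> \<le> C / (1 + t\<^sup>2)" using hermite_fun_decay by blast
  note h = continuous_hermite_fun[of UNIV 15] C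
  have lat: "scaled_int_lattice a = range ?e" by (auto simp: scaled_int_lattice_def)
  have inj: "inj ?e" using T by (auto simp: inj_on_def)
  have defect: "(\<lambda>(j, m). norm (adjoint_defect T a ?h 1 j m)) = lattice_weight \<delta>"
    using norm_hermite_adjoint_defect[OF \<delta>] by (auto simp: T_def a_def)
  have key: "\<exists>S. ((\<lambda>z. (norm (L2_inner f (?\<phi> z)))\<^sup>2) has_sum S) (scaled_int_lattice a) \<and>
      \<bar>S - \<delta> * energy f\<bar> \<le> \<delta> * (95/100) * energy f" if f_cs: "f \<in> compactly_supported" for f
  proof -
    obtain R where f: "continuous_on UNIV f" "\<And>t. \<bar>t\<bar> > R \<Longrightarrow> f t = 0"
      using f_cs unfolding compactly_supported_def by blast
    have e: "(LINT t|lborel. (norm (f t))\<^sup>2) = energy f"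
      unfolding energy_def
      using borel_measurable_continuous_onI[OF f(1)] by (intro integral_completion[symmetric]) simp
    obtain S where S: "((\<lambda>(k, l). (norm (gabor_coeff T a ?h f k l))\<^sup>2) has_sum S) UNIV"
      "\<bar>S - T / a * 1 * energy f\<bar> \<le> T / a * (95/100) * energy f"
      using gabor_coeff_estimate[OF T(1,2) h f, where N = 1 and s = "95/100"] lattice_weight_summable[OF assms]
      unfolding defect e by blast
    have "(norm (L2_inner f (?\<phi> (?e p))))\<^sup>2 = (case p of (k, l) \<Rightarrow> (norm (gabor_coeff T a ?h f k l))\<^sup>2)" for p
      using L2_inner_tf_shift[OF f(1) h(1) T(1), of a] T(3) by (cases p) (simp add: gabor_system_def)
    hence "((\<lambda>z. (norm (L2_inner f (?\<phi> z)))\<^sup>2) has_sum S) (range ?e)"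
      using S(1) by (subst has_sum_reindex[OF inj]) (simp add: o_def)
    thus ?thesis using S(2) T(4) lat by auto
  qed
  have "L2_frame (scaled_int_lattice a) ?\<phi>"
  proof (rule L2_frame_from_dense[where A = "\<delta> * (5/100)" and B = "\<delta> * (195/100)"])
    show "?\<phi> z \<in> L2" for z
      using tf_shift_L2[OF h] by (cases z) (simp add: gabor_system_def)
    fix f assume f: "f \<in> compactly_supported"
    obtain S where S: "((\<lambda>z. (norm (L2_inner f (?\<phi> z)))\<^sup>2) has_sum S) (scaled_int_lattice a)"
      "\<bar>S - \<delta> * energy f\<bar> \<le> \<delta> * (95/100) * energy f" using key[OF f] by blast
    show "(\<lambda>z. (norm (L2_inner f (?\<phi> z)))\<^sup>2) summable_on scaled_int_lattice a"
      using S(1) by (auto simp: summable_on_def)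
    define D where "D = \<delta> * energy f"
    have "\<bar>S - D\<bar> \<le> 95/100 * D" using S(2) by (simp add: D_def)
    hence "5/100 * D \<le> S" "S \<le> 195/100 * D" by linarith+
    thus "\<delta> * (5/100) * energy f \<le> (\<Sum>\<^sub>\<infinity>z\<in>scaled_int_lattice a. (norm (L2_inner f (?\<phi> z)))\<^sup>2)"
      "(\<Sum>\<^sub>\<infinity>z\<in>scaled_int_lattice a. (norm (L2_inner f (?\<phi> z)))\<^sup>2) \<le> \<delta> * (195/100) * energy f"
      unfolding infsumI[OF S(1)] by (simp_all add: D_def)
  qed (use \<delta> in auto)
  thus ?thesis by (simp add: gabor_frame_def a_def)
qed

end
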